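(* Let $(X,Y),(X_1,Y_1),\dots,(X_n,Y_n)$ be i.i.d. random pairs in $\mathbb R^d\times\mathbb R$ with $\mathbb E\|X\|^2<+\infty$ and $\mathbb E[Y^2]<+\infty$. Assume that $\Sigma=\mathbb E[XX^\top]$ is invertible and that $\widehat\Sigma_n=\frac1n\sum_{i=1}^nX_iX_i^\top$ is invertible almost surely. For the Gaussian linear family $\mathcal F=\{f_\theta(\cdot\mid x)=\mathcal N(\langle\theta,x\rangle,1):\theta\in\mathbb R^d\}$, the (unpenalized) Sample Minmax Predictor is given by $$\widetilde f_n(\cdot\mid x)=\mathcal N\Big(\langle\widehat\theta_n,x\rangle,\ \big(1+\langle(n\widehat\Sigma_n)^{-1}x,x\rangle\big)^2\Big),$$ where $\widehat\theta_n=\widehat\Sigma_n^{-1}\big(\frac1n\sum_{i=1}^nY_iX_i\big)$ is the ordinary least squares estimator. In addition, $$\mathbb E\big[\mathcal E(\widetilde f_n)\big]\le\mathbb E\Big[-\log\Big(1-\big\langle(n\widehat\Sigma_n+XX^\top)^{-1}X,X\big\rangle\Big)\Big]\le\log\Big(1+\frac1n\mathbb E\big[\operatorname{tr}(\widetilde\Sigma_n^{-1})\big]\Big),$$ where $\widetilde\Sigma_n=\Sigma^{-1/2}\widehat\Sigma_n\Sigma^{-1/2}$.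
   Context: Densities on $\mathbb R$ are taken with respect to $\mu(dy)=(2\pi)^{-1/2}dy$. For a conditional density $g(y\mid x)$ the risk is $\mathcal R(g)=\mathbb E[-\log g(Y\mid X)]$ and the excess risk is $\mathcal E(g)=\mathcal R(g)-\inf_{\theta\in\mathbb R^d}\mathcal R(f_\theta)$; for an estimator $\widetilde f_n$, $\mathbb E[\mathcal E(\widetilde f_n)]$ is the expectation over the sample. The (unpenalized) Sample Minmax Predictor is the conditional density $$\widetilde f_n(y\mid x)=\frac{f_{\widehat\theta_n^{(x,y)}}(y\mid x)}{\int_{\mathbb R} f_{\widehat\theta_n^{(x,y')}}(y'\mid x)\,\mu(dy')},\qquad \widehat\theta_n^{(x,y)}=\operatorname*{arg\,min}_{\theta\in\mathbb R^d}\Big\{-\sum_{i=1}^n\log f_\theta(Y_i\mid X_i)-\log f_\theta(y\mid x)\Big\}.$$ The right-hand sides are allowed to be $+\infty$. *)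

theory Defs
  imports "HOL-Probability.Probability"
begin

text \<open>Extended logarithm, with \<open>log 0 = -\<infinity>\<close> and \<open>log \<infinity> = \<infinity>\<close> (whereas \<open>ln 0 = 0\<close> in HOL).\<close>

definition elog :: "ereal \<Rightarrow> ereal" where
  "elog x = (if x \<le> 0 then -\<infinity> else if x = \<infinity> then \<infinity> else ereal (ln (real_of_ereal x)))"

text \<open>Expectation of an extended-real function as the difference of the integrals of its positive
  and negative parts (\<open>e2ennreal\<close> sends negative arguments to 0), so that the value \<open>\<infinity>\<close> is
  allowed and not replaced by the default 0 of the Bochner integral.\<close>

definition eexpectation :: "'w measure \<Rightarrow> ('w \<Rightarrow> ereal) \<Rightarrow> ereal" where
  "eexpectation M h =
     enn2ereal (\<integral>\<^sup>+\<omega>. e2ennreal (h \<omega>) \<partial>M) - enn2ereal (\<integral>\<^sup>+\<omega>. e2ennreal (- h \<omega>) \<partial>M)"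

definition mu :: "real measure" where
  "mu = density lborel (\<lambda>_. ennreal (1 / sqrt (2 * pi)))"

text \<open>Conditional densities \<open>g(y | x)\<close> are written \<open>g x y\<close> and are densities with respect to \<open>mu\<close>.\<close>

definition risk :: "'w measure \<Rightarrow> ('w \<Rightarrow> 'x) \<Rightarrow> ('w \<Rightarrow> real) \<Rightarrow> ('x \<Rightarrow> real \<Rightarrow> real) \<Rightarrow> ereal" where
  "risk M X Y g = eexpectation M (\<lambda>\<omega>. - elog (ereal (g (X \<omega>) (Y \<omega>))))"

definition excess_risk ::
  "'w measure \<Rightarrow> ('w \<Rightarrow> 'x) \<Rightarrow> ('w \<Rightarrow> real) \<Rightarrow> ('p \<Rightarrow> 'x \<Rightarrow> real \<Rightarrow> real) \<Rightarrow> ('x \<Rightarrow> real \<Rightarrow> real) \<Rightarrow> ereal"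
  where "excess_risk M X Y f g = risk M X Y g - (INF \<theta>. risk M X Y (f \<theta>))"

text \<open>The sample consists of \<open>(xs i, ys i)\<close> for \<open>i = 1, \<dots>, n\<close>.\<close>

definition augmented_mle ::
  "('p \<Rightarrow> 'x \<Rightarrow> real \<Rightarrow> real) \<Rightarrow> nat \<Rightarrow> (nat \<Rightarrow> 'x) \<Rightarrow> (nat \<Rightarrow> real) \<Rightarrow> 'x \<Rightarrow> real \<Rightarrow> 'p" where
  "augmented_mle f n xs ys x y =
     arg_min (\<lambda>\<theta>. - (\<Sum>i=1..n. elog (ereal (f \<theta> (xs i) (ys i)))) - elog (ereal (f \<theta> x y)))
             (\<lambda>_. True)"

definition sample_minmax ::
  "('p \<Rightarrow> 'x \<Rightarrow> real \<Rightarrow> real) \<Rightarrow> nat \<Rightarrow> (nat \<Rightarrow> 'x) \<Rightarrow> (nat \<Rightarrow> real) \<Rightarrow> 'x \<Rightarrow> real \<Rightarrow> real" where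
  "sample_minmax f n xs ys x y =
     f (augmented_mle f n xs ys x y) x y / (\<integral>y'. f (augmented_mle f n xs ys x y') x y' \<partial>mu)"

text \<open>Density of \<open>N(m, v)\<close>, of mean \<open>m\<close> and variance \<open>v\<close>, with respect to \<open>mu\<close>; the library's
  \<open>normal_density\<close> takes the standard deviation and is a density with respect to \<open>lborel\<close>.\<close>

definition gaussian :: "real \<Rightarrow> real \<Rightarrow> real \<Rightarrow> real" where
  "gaussian m v y = sqrt (2 * pi) * normal_density m (sqrt v) y"

lemma density_mu_gaussian:
  "density mu (\<lambda>y. ennreal (gaussian m v y)) =
   density lborel (\<lambda>y. ennreal (normal_density m (sqrt v) y))"
proof -
  have "ennreal (1 / sqrt (2 * pi)) * ennreal (gaussian m v y)
      = ennreal (normal_density m (sqrt v) y)" for y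
    by (subst ennreal_mult'[symmetric]) (auto simp: gaussian_def)
  then show ?thesis
    unfolding mu_def
    by (subst density_density_eq) (auto simp: gaussian_def[abs_def])
qed

definition gaussian_linear :: "real ^ 'd \<Rightarrow> real ^ 'd \<Rightarrow> real \<Rightarrow> real" where
  "gaussian_linear \<theta> x = gaussian (\<theta> \<bullet> x) 1"

definition outer :: "real ^ 'd \<Rightarrow> real ^ 'd ^ 'd" where
  "outer x = (\<chi> i j. x $ i * x $ j)"

definition emp_cov :: "nat \<Rightarrow> (nat \<Rightarrow> real ^ 'd) \<Rightarrow> real ^ 'd ^ 'd" where
  "emp_cov n xs = (1 / real n) *\<^sub>R (\<Sum>i=1..n. outer (xs i))"

definition ols :: "nat \<Rightarrow> (nat \<Rightarrow> real ^ 'd) \<Rightarrow> (nat \<Rightarrow> real) \<Rightarrow> real ^ 'd" where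
  "ols n xs ys = matrix_inv (emp_cov n xs) *v ((1 / real n) *\<^sub>R (\<Sum>i=1..n. ys i *\<^sub>R xs i))"

definition psd_sqrt :: "real ^ 'd ^ 'd \<Rightarrow> real ^ 'd ^ 'd" where
  "psd_sqrt A = (THE S. transpose S = S \<and> (\<forall>x. 0 \<le> (S *v x) \<bullet> x) \<and> S ** S = A)"

text \<open>\<open>whiten S A\<close> is \<open>S\<^sup>-\<^sup>1\<^sup>/\<^sup>2 A S\<^sup>-\<^sup>1\<^sup>/\<^sup>2\<close>.\<close>

definition whiten :: "real ^ 'd ^ 'd \<Rightarrow> real ^ 'd ^ 'd \<Rightarrow> real ^ 'd ^ 'd" where
  "whiten S A = psd_sqrt (matrix_inv S) ** A ** psd_sqrt (matrix_inv S)"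

end

theory Submission
  imports Defs
begin

text \<open>Adding the test point \<open>(x, y)\<close> to the sample divides the least squares residual at that point
  by \<open>1 + h\<close>, where \<open>h = \<langle>(n \<Sigma>\<^sub>n)\<^sup>-\<^sup>1 x, x\<rangle>\<close> is its leverage and \<open>\<Sigma>\<^sub>n\<close> the empirical covariance
  (a rank one update). Hence the unnormalized predictor is a Gaussian density in \<open>y\<close> with mass
  \<open>1 + h\<close>, and its log loss equals \<open>log (1 + h)\<close> plus the loss, at the test point, of the least
  squares estimator trained on all \<open>n + 1\<close> points. By exchangeability the latter has the same
  expectation at each of the \<open>n + 1\<close> points, so it is at most the risk of every fixed parameter.
  The second inequality is Jensen's, together with \<open>1 - \<langle>(n \<Sigma>\<^sub>n + x x\<^sup>T)\<^sup>-\<^sup>1 x, x\<rangle> = 1 / (1 + h)\<close> and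
  \<open>E h = E (tr ((n \<Sigma>\<^sub>n)\<^sup>-\<^sup>1 \<Sigma>))\<close>.\<close>

subsection \<open>Least squares and rank one updates\<close>

lemma matrix_inv_mult:
  fixes A :: "'a::semiring_1 ^ 'n ^ 'm"
  assumes "invertible A"
  shows matrix_inv_right: "A ** matrix_inv A = mat 1"
    and matrix_inv_left: "matrix_inv A ** A = mat 1"
  using someI_ex[OF assms[unfolded invertible_def]] unfolding matrix_inv_def by auto

lemma matrix_inv_eqI:
  fixes A B :: "real ^ 'n ^ 'n"
  assumes "A ** B = mat 1"
  shows "matrix_inv A = B"
proof -
  have inv: "invertible A"
    using assms invertible_right_inverse by blast
  have "matrix_inv A = matrix_inv A ** (A ** B)"
    by (simp add: assms)
  also have "\<dots> = B"
    by (simp add: matrix_mul_assoc matrix_inv_left[OF inv])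
  finally show ?thesis .
qed

lemma matrix_inv_vector_eqI:
  fixes A :: "real ^ 'n ^ 'n"
  assumes "invertible A" and "A *v v = b"
  shows "matrix_inv A *v b = v"
  unfolding assms(2)[symmetric]
  by (simp add: matrix_vector_mul_assoc matrix_inv_left[OF assms(1)])

lemma matrix_inv_vector_cancel:
  fixes A :: "real ^ 'n ^ 'n"
  assumes "invertible A"
  shows "A *v (matrix_inv A *v b) = b"
  by (simp add: matrix_vector_mul_assoc matrix_inv_right[OF assms])

lemma invertible_scaleR:
  fixes A :: "real ^ 'n ^ 'n"
  assumes "invertible A" "c \<noteq> 0"
  shows "invertible (c *\<^sub>R A)" "matrix_inv (c *\<^sub>R A) = (1 / c) *\<^sub>R matrix_inv A"
proof -
  have "(c *\<^sub>R A) ** ((1 / c) *\<^sub>R matrix_inv A) = mat 1"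
    using assms by (simp add: matrix_inv_right matrix_scalar_ac flip: scalar_matrix_assoc)
  then show "invertible (c *\<^sub>R A)" "matrix_inv (c *\<^sub>R A) = (1 / c) *\<^sub>R matrix_inv A"
    using invertible_right_inverse matrix_inv_eqI by blast+
qed

section \<open>Gram matrices as positive forms\<close>

lemma outer_mult: "outer x *v v = (x \<bullet> v) *\<^sub>R x"
  by (simp add: vec_eq_iff outer_def matrix_vector_mult_def inner_vec_def sum_distrib_left
      sum_distrib_right mult_ac)

text \<open>This is the unnormalized covariance. The arbitrary index set makes adding a test point
  the same as inserting an index.\<close>

definition gram :: "'i set \<Rightarrow> ('i \<Rightarrow> real ^ 'd) \<Rightarrow> real ^ 'd ^ 'd" where
  "gram J xs = (\<Sum>j\<in>J. outer (xs j))"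

lemma gram_mult: "gram J xs *v v = (\<Sum>j\<in>J. (xs j \<bullet> v) *\<^sub>R xs j)"
  unfolding gram_def
  by (induction J rule: infinite_finite_induct)
     (auto simp: matrix_vector_mult_add_rdistrib outer_mult)

lemma gram_quadratic: "(gram J xs *v v) \<bullet> v = (\<Sum>j\<in>J. (xs j \<bullet> v)\<^sup>2)"
  by (simp add: gram_mult inner_sum_left power2_eq_square)

text \<open>If the sum of squares vanished, every \<open>xs j\<close> would be orthogonal to
  \<open>v\<close>, so the Gram matrix would kill \<open>v\<close>.\<close>

lemma gram_pos:
  assumes "finite J" "invertible (gram J xs)" "v \<noteq> 0"
  shows "0 < (\<Sum>j\<in>J. (xs j \<bullet> v)\<^sup>2)"
proof (rule ccontr)
  assume "\<not> ?thesis"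
  then have "(\<Sum>j\<in>J. (xs j \<bullet> v)\<^sup>2) = 0"
    by (meson not_less order_antisym sum_nonneg zero_le_power2)
  then have "\<forall>j\<in>J. xs j \<bullet> v = 0"
    using assms(1) by (simp add: sum_nonneg_eq_0_iff)
  then have "gram J xs *v v = 0"
    by (simp add: gram_mult)
  then have "v = 0"
    using matrix_inv_vector_eqI[OF assms(2), of v 0] by simp
  with assms(3) show False by simp
qed

lemma invertible_gramI:
  assumes "finite J" "\<And>v. v \<noteq> 0 \<Longrightarrow> 0 < (\<Sum>j\<in>J. (xs j \<bullet> v)\<^sup>2)"
  shows "invertible (gram J xs)"
proof -
  have "v = 0" if "gram J xs *v v = 0" for v
    using assms(2)[of v] that gram_quadratic[of J xs v] by (cases "v = 0") auto
  then show ?thesis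
    using matrix_left_invertible_ker invertible_left_inverse by blast
qed

text \<open>For Gram matrices invertibility is positive definiteness, and further points only add
  squares to the quadratic form. This carries invertibility from the \<open>n\<close> sample points
  to all \<open>n + 1\<close> points.\<close>

lemma invertible_gram_mono:
  assumes "finite K" "J \<subseteq> K" "invertible (gram J xs)"
  shows "invertible (gram K xs)"
proof (rule invertible_gramI[OF assms(1)])
  fix v :: "real ^ 'b" assume "v \<noteq> 0"
  then have "0 < (\<Sum>j\<in>J. (xs j \<bullet> v)\<^sup>2)"
    using gram_pos assms finite_subset by blast
  also have "\<dots> \<le> (\<Sum>j\<in>K. (xs j \<bullet> v)\<^sup>2)"
    by (intro sum_mono2 assms) auto
  finally show "0 < (\<Sum>j\<in>K. (xs j \<bullet> v)\<^sup>2)" .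
qed

section \<open>Least squares: normal equations and optimality\<close>

definition least_squares :: "'i set \<Rightarrow> ('i \<Rightarrow> real ^ 'd) \<Rightarrow> ('i \<Rightarrow> real) \<Rightarrow> real ^ 'd" where
  "least_squares J xs ys = matrix_inv (gram J xs) *v (\<Sum>j\<in>J. ys j *\<^sub>R xs j)"

text \<open>The normal equations make the residuals orthogonal to every vector of the form
  \<open>xs j \<bullet> d\<close>, so the cross term vanishes when the squares are expanded.\<close>

lemma least_squares_pythagoras:
  assumes "finite J" "invertible (gram J xs)"
  shows "(\<Sum>j\<in>J. (ys j - \<theta> \<bullet> xs j)\<^sup>2)
    = (\<Sum>j\<in>J. (ys j - least_squares J xs ys \<bullet> xs j)\<^sup>2)
      + (\<Sum>j\<in>J. (xs j \<bullet> (\<theta> - least_squares J xs ys))\<^sup>2)"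
proof -
  let ?t = "least_squares J xs ys"
  let ?d = "\<theta> - ?t"
  have "gram J xs *v ?t = (\<Sum>j\<in>J. ys j *\<^sub>R xs j)"
    unfolding least_squares_def by (rule matrix_inv_vector_cancel[OF assms(2)])
  then have "(\<Sum>j\<in>J. (xs j \<bullet> ?t) *\<^sub>R xs j) \<bullet> ?d = (\<Sum>j\<in>J. ys j *\<^sub>R xs j) \<bullet> ?d"
    by (simp add: gram_mult)
  then have "(\<Sum>j\<in>J. (xs j \<bullet> ?t) * (xs j \<bullet> ?d)) = (\<Sum>j\<in>J. ys j * (xs j \<bullet> ?d))"
    unfolding inner_sum_left inner_scaleR_left .
  then have normal: "(\<Sum>j\<in>J. (ys j - ?t \<bullet> xs j) * (xs j \<bullet> ?d)) = 0"
    unfolding left_diff_distrib sum_subtractf inner_commute[of ?t] by simp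
  have "(ys j - \<theta> \<bullet> xs j)\<^sup>2 = (ys j - ?t \<bullet> xs j)\<^sup>2 + (xs j \<bullet> ?d)\<^sup>2
      - 2 * ((ys j - ?t \<bullet> xs j) * (xs j \<bullet> ?d))" for j
    by (simp add: power2_eq_square algebra_simps inner_commute)
  then show ?thesis
    using normal by (simp add: sum.distrib sum_subtractf flip: sum_distrib_left)
qed

lemma least_squares_le:
  assumes "finite J" "invertible (gram J xs)"
  shows "(\<Sum>j\<in>J. (ys j - least_squares J xs ys \<bullet> xs j)\<^sup>2) \<le> (\<Sum>j\<in>J. (ys j - \<theta> \<bullet> xs j)\<^sup>2)"
  unfolding least_squares_pythagoras[OF assms, of ys \<theta>] by (simp add: sum_nonneg)

text \<open>By Pythagoras a competitor that does as well has a vanishing quadratic form at its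
  difference from the estimator, and the form is definite. Uniqueness is what determines the value
  of \<open>arg_min\<close>, which is a choice among minimizers.\<close>

lemma least_squares_unique:
  assumes "finite J" "invertible (gram J xs)"
    and "(\<Sum>j\<in>J. (ys j - \<theta> \<bullet> xs j)\<^sup>2) \<le> (\<Sum>j\<in>J. (ys j - least_squares J xs ys \<bullet> xs j)\<^sup>2)"
  shows "\<theta> = least_squares J xs ys"
  using gram_pos[OF assms(1,2), of "\<theta> - least_squares J xs ys"] assms(3)
    least_squares_pythagoras[OF assms(1,2), of ys \<theta>] by fastforce

section \<open>Leverage and the rank one update\<close>

definition leverage :: "'i set \<Rightarrow> ('i \<Rightarrow> real ^ 'd) \<Rightarrow> real ^ 'd \<Rightarrow> real" where
  "leverage J xs x = (matrix_inv (gram J xs) *v x) \<bullet> x"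

lemma leverage_nonneg:
  assumes "invertible (gram J xs)"
  shows "0 \<le> leverage J xs x"
proof -
  let ?v = "matrix_inv (gram J xs) *v x"
  have "leverage J xs x = (gram J xs *v ?v) \<bullet> ?v"
    by (simp add: leverage_def matrix_inv_vector_cancel[OF assms] inner_commute)
  then show ?thesis
    by (simp add: gram_quadratic sum_nonneg)
qed

lemma gram_insert:
  assumes "finite J" "k \<notin> J"
  shows "gram (insert k J) xs = gram J xs + outer (xs k)"
  using assms by (simp add: gram_def add.commute)

text \<open>A Sherman-Morrison argument without the formula for the full inverse: only the updated
  solution and the image of \<open>xs k\<close> are needed, and both are guessed along the direction
  \<open>?u\<close> and then verified.\<close>

lemma least_squares_insert:
  assumes J: "finite J" "k \<notin> J" and inv: "invertible (gram J xs)"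
  defines "h \<equiv> leverage J xs (xs k)"
  shows "ys k - least_squares (insert k J) xs ys \<bullet> xs k
      = (ys k - least_squares J xs ys \<bullet> xs k) / (1 + h)"
    and "leverage (insert k J) xs (xs k) = h / (1 + h)"
proof -
  have h: "1 + h > 0"
    using leverage_nonneg[OF inv, of "xs k"] by (simp add: h_def)
  let ?t = "least_squares J xs ys" and ?u = "matrix_inv (gram J xs) *v xs k"
  \<comment> \<open>The correction \<open>c\<close> along \<open>?u\<close> is forced by the updated
    normal equations, which at \<open>xs k\<close> read
    \<open>ys k = c + xs k \<bullet> ?t + c * h\<close>. It turns out to be the new residual
    itself.\<close>
  define c where "c = (ys k - ?t \<bullet> xs k) / (1 + h)"
  have c: "c * (1 + h) = ys k - ?t \<bullet> xs k"
    using h by (simp add: c_def)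
  have inv': "invertible (gram (insert k J) xs)"
    using J by (intro invertible_gram_mono[OF _ _ inv]) auto
  have u: "gram J xs *v ?u = xs k" "xs k \<bullet> ?u = h"
    by (simp_all add: matrix_inv_vector_cancel[OF inv] h_def leverage_def inner_commute)
  have t: "gram J xs *v ?t = (\<Sum>j\<in>J. ys j *\<^sub>R xs j)"
    unfolding least_squares_def by (rule matrix_inv_vector_cancel[OF inv])
  have "gram (insert k J) xs *v (?t + c *\<^sub>R ?u)
      = (\<Sum>j\<in>J. ys j *\<^sub>R xs j) + c *\<^sub>R xs k + (xs k \<bullet> ?t + c * h) *\<^sub>R xs k"
    unfolding gram_insert[OF J]
    by (simp add: matrix_vector_mult_add_rdistrib outer_mult matrix_vector_right_distrib
        matrix_vector_mult_scaleR t u inner_add_right algebra_simps)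
  also have "\<dots> = (\<Sum>j\<in>insert k J. ys j *\<^sub>R xs j)"
  proof -
    have "ys k = c + (xs k \<bullet> ?t + c * h)"
      using c by (simp add: algebra_simps inner_commute)
    then show ?thesis
      using J by (simp add: scaleR_add_left)
  qed
  finally have "least_squares (insert k J) xs ys = ?t + c *\<^sub>R ?u"
    unfolding least_squares_def[of "insert k J"] by (rule matrix_inv_vector_eqI[OF inv'])
  then have "ys k - least_squares (insert k J) xs ys \<bullet> xs k = (ys k - ?t \<bullet> xs k) - c * h"
    using u by (simp add: inner_add_right inner_commute[of _ "xs k"])
  also have "\<dots> = c"
    using c by (simp add: algebra_simps)
  finally show "ys k - least_squares (insert k J) xs ys \<bullet> xs k
      = (ys k - ?t \<bullet> xs k) / (1 + h)"
    by (simp add: c_def)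
  \<comment> \<open>The old Gram matrix sends \<open>?u\<close> to \<open>xs k\<close> and the rank
    one term sends it to \<open>h\<close> times \<open>xs k\<close>, so the updated matrix
    multiplies by \<open>1 + h\<close> in total.\<close>
  have "gram (insert k J) xs *v ((1 / (1 + h)) *\<^sub>R ?u) = (1 / (1 + h) + h / (1 + h)) *\<^sub>R xs k"
    unfolding gram_insert[OF J]
    by (simp add: matrix_vector_mult_add_rdistrib outer_mult matrix_vector_mult_scaleR u
        scaleR_add_left scaleR_add_right)
  also have "\<dots> = xs k"
    using h by (simp flip: add_divide_distrib)
  finally have "matrix_inv (gram (insert k J) xs) *v xs k = (1 / (1 + h)) *\<^sub>R ?u"
    by (rule matrix_inv_vector_eqI[OF inv'])
  then show "leverage (insert k J) xs (xs k) = h / (1 + h)"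
    using u by (simp add: leverage_def inner_commute)
qed

section \<open>Passage from the empirical covariance to the Gram matrix\<close>

lemma gram_emp_cov:
  assumes "0 < n"
  shows "emp_cov n xs = (1 / real n) *\<^sub>R gram {1..n} xs"
    and "real n *\<^sub>R emp_cov n xs = gram {1..n} xs"
  using assms by (simp_all add: emp_cov_def gram_def)

lemma invertible_emp_cov:
  assumes "invertible (emp_cov n xs)"
  shows "0 < n" "invertible (gram {1..n} xs)"
proof -
  show "0 < n"
  proof (rule ccontr)
    assume "\<not> 0 < n"
    \<comment> \<open>For \<open>n = 0\<close> the sum is empty and the covariance is the zero
      matrix, which cannot reach the vector 1. Positivity of \<open>n\<close> thus follows from
      invertibility.\<close>
    then have "emp_cov n xs = 0"
      by (simp add: emp_cov_def)
    then show False
      using matrix_inv_vector_cancel[OF assms, of 1] by simp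
  qed
  then show "invertible (gram {1..n} xs)"
    using invertible_scaleR(1)[OF assms, of "real n"] gram_emp_cov(2)[of n xs] by simp
qed

lemma ols_eq_least_squares:
  assumes "invertible (emp_cov n xs)"
  shows "ols n xs ys = least_squares {1..n} xs ys"
proof -
  note n = invertible_emp_cov[OF assms]
  show ?thesis
    unfolding ols_def least_squares_def gram_emp_cov(1)[OF n(1)]
    using n by (subst invertible_scaleR(2))
      (auto simp: matrix_vector_mult_scaleR scaleR_matrix_vector_assoc[symmetric])
qed

subsection \<open>The predictor in closed form\<close>

text \<open>The factor \<open>sqrt (2 * pi)\<close> absorbed into \<open>mu\<close> cancels the
  usual normalization, leaving only the standard deviation \<open>s\<close> in the
  denominator.\<close>

lemma gaussian_eq_exp:
  assumes "0 < s"
  shows "gaussian m (s\<^sup>2) y = exp (- ((y - m) / s)\<^sup>2 / 2) / s"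
  using assms
  by (simp add: gaussian_def normal_density_def real_sqrt_mult power_divide field_simps)

lemma elog_exp: "elog (ereal (exp r)) = ereal r"
  by (simp add: elog_def)

lemma gaussian_linear_eq_exp: "gaussian_linear \<theta> x y = exp (- (y - \<theta> \<bullet> x)\<^sup>2 / 2)"
  using gaussian_eq_exp[of 1 "\<theta> \<bullet> x" y] by (simp add: gaussian_linear_def)

lemma integral_mu: "f \<in> borel_measurable borel \<Longrightarrow> (\<integral>y. f y \<partial>mu) = (\<integral>y. f y / sqrt (2 * pi) \<partial>lborel)"
  for f :: "real \<Rightarrow> real"
  unfolding mu_def by (subst integral_density) auto

lemma integral_mu_gaussian:
  assumes "0 < v"
  shows "(\<integral>y. gaussian m v y \<partial>mu) = 1"
  using assms by (subst integral_mu) (auto simp: gaussian_def[abs_def])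

text \<open>With unit variance the negative log-likelihood is exactly half the sum of squares. The
  test point is stored at the free index 0, so the augmented problem is ordinary least squares on
  \<open>{0..n}\<close>.\<close>

lemma augmented_mle_eq:
  fixes xs :: "nat \<Rightarrow> real ^ 'd"
  assumes "invertible (emp_cov n xs)"
  shows "augmented_mle gaussian_linear n xs ys x y
    = least_squares {0..n} (xs(0 := x)) (ys(0 := y))"
proof -
  let ?xs = "xs(0 := x)" and ?ys = "ys(0 := y)"
  let ?L = "\<lambda>\<theta>. (\<Sum>j\<in>{0..n}. (?ys j - \<theta> \<bullet> ?xs j)\<^sup>2)"
  have split: "{0..n} = insert 0 {1..n}"
    by auto
  have "gram {1..n} ?xs = gram {1..n} xs"
    by (simp add: gram_def)
  then have inv: "invertible (gram {0..n} ?xs)"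
    using invertible_emp_cov(2)[OF assms] invertible_gram_mono[of "{0..n}" "{1..n}" ?xs]
    by auto
  have "- (\<Sum>i=1..n. elog (ereal (gaussian_linear \<theta> (xs i) (ys i))))
      - elog (ereal (gaussian_linear \<theta> x y)) = ereal (?L \<theta> / 2)" for \<theta>
    unfolding gaussian_linear_eq_exp elog_exp split
    by (simp add: sum_negf sum_divide_distrib[symmetric] add_divide_distrib)
  then have "augmented_mle gaussian_linear n xs ys x y
      = arg_min (\<lambda>\<theta>. ereal (?L \<theta> / 2)) (\<lambda>_. True)"
    unfolding augmented_mle_def by simp
  moreover have "is_arg_min (\<lambda>\<theta>. ereal (?L \<theta> / 2)) (\<lambda>_. True) \<theta>
      \<longleftrightarrow> \<theta> = least_squares {0..n} ?xs ?ys" for \<theta>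
    unfolding is_arg_min_linorder
    using least_squares_le[OF _ inv, of ?ys] least_squares_unique[OF _ inv, of ?ys \<theta>]
    by auto
  ultimately show ?thesis
    by (simp add: arg_min_def)
qed

text \<open>The augmented residual at \<open>(x, y')\<close> is \<open>(y' - m) / (1 + h)\<close>.
  Hence the numerator is \<open>1 + h\<close> times a normalized Gaussian with standard deviation
  \<open>1 + h\<close>, and the factor \<open>1 + h\<close> cancels against the integral.\<close>

lemma sample_minmax_gaussian_linear:
  fixes xs :: "nat \<Rightarrow> real ^ 'd"
  assumes inv: "invertible (emp_cov n xs)"
  shows "sample_minmax gaussian_linear n xs ys x
    = gaussian (ols n xs ys \<bullet> x) ((1 + leverage {1..n} xs x)\<^sup>2)"
proof
  fix y
  define h where "h = leverage {1..n} xs x"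
  define m where "m = ols n xs ys \<bullet> x"
  note inv' = invertible_emp_cov(2)[OF inv]
  have h: "0 < 1 + h"
    using leverage_nonneg[OF inv', of x] by (simp add: h_def)
  have split: "{0..n} = insert 0 {1..n}"
    by auto
  have "y' - least_squares {0..n} (xs(0 := x)) (ys(0 := y')) \<bullet> x = (y' - m) / (1 + h)" for y'
  proof -
    let ?xs = "xs(0 := x)" and ?ys = "ys(0 := y')"
    \<comment> \<open>Index 0 lies outside \<open>{1..n}\<close>, so storing the test point there
      leaves the sample quantities unchanged.\<close>
    have g: "gram {1..n} ?xs = gram {1..n} xs"
      "least_squares {1..n} ?xs ?ys = least_squares {1..n} xs ys"
      by (simp_all add: gram_def least_squares_def)
    show ?thesis
      using least_squares_insert(1)[of "{1..n}" 0 ?xs ?ys] inv'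
      unfolding split g leverage_def
      by (simp add: g h_def m_def leverage_def ols_eq_least_squares[OF inv])
  qed
  then have f: "gaussian_linear (augmented_mle gaussian_linear n xs ys x y') x y'
      = (1 + h) * gaussian m ((1 + h)\<^sup>2) y'" for y'
    unfolding augmented_mle_eq[OF inv] gaussian_linear_eq_exp gaussian_eq_exp[OF h]
    using h by simp
  show "sample_minmax gaussian_linear n xs ys x y = gaussian m ((1 + h)\<^sup>2) y"
    unfolding sample_minmax_def f using h by (simp add: integral_mu_gaussian)
qed

subsection \<open>Positive semidefinite square roots\<close>

lemma symmetric_inner:
  fixes A :: "real ^ 'n ^ 'n"
  assumes "transpose A = A"
  shows "(A *v x) \<bullet> y = x \<bullet> (A *v y)"
  by (metis assms dot_lmul_matrix transpose_matrix_vector)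

text \<open>The quadratic form attains its maximum on the unit sphere of \<open>V\<close>, and a
  maximizer is an eigenvector. Invariance of \<open>V\<close> keeps the defect \<open>w\<close>
  inside \<open>V\<close>, where it is an admissible direction of variation.\<close>

lemma symmetric_eigenvector:
  fixes A :: "real ^ 'n ^ 'n"
  assumes A: "transpose A = A" and V: "subspace V" "V \<noteq> {0}" and AV: "\<And>x. x \<in> V \<Longrightarrow> A *v x \<in> V"
  obtains v c where "v \<in> V" "norm v = 1" "A *v v = c *\<^sub>R v"
proof -
  let ?q = "\<lambda>x. (A *v x) \<bullet> x"
  let ?S = "V \<inter> sphere 0 1"
  obtain u where u: "u \<in> V" "u \<noteq> 0"
    using V subspace_0 by blast
  then have "(1 / norm u) *\<^sub>R u \<in> ?S"
    using V by (auto simp: subspace_scale)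
  then have "?S \<noteq> {}"
    by blast
  moreover have "compact ?S"
    using closed_subspace[OF V(1)] by (intro closed_Int_compact) auto
  moreover have "continuous_on ?S ?q"
    by (intro continuous_intros linear_continuous_on_compose matrix_vector_mul_linear)
  ultimately have "\<exists>v\<in>?S. \<forall>x\<in>?S. ?q x \<le> ?q v"
    by (intro continuous_attains_sup)
  then obtain v where v: "v \<in> ?S" "\<And>x. x \<in> ?S \<Longrightarrow> ?q x \<le> ?q v"
    by blast
  define c where "c = ?q v"
  have le: "?q x \<le> c * (norm x)\<^sup>2" if "x \<in> V" for x
  proof (cases "x = 0")
    case False
    then have "(1 / norm x) *\<^sub>R x \<in> ?S"
      using V that by (auto simp: subspace_scale)
    from v(2)[OF this] have "?q x / (norm x)\<^sup>2 \<le> c"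
      by (simp add: c_def matrix_vector_mult_scaleR power2_eq_square)
    then show ?thesis
      using False by (simp add: field_simps)
  qed simp
  define w where "w = A *v v - c *\<^sub>R v"
  have wV: "w \<in> V"
    unfolding w_def using v V AV by (auto intro!: subspace_diff subspace_scale)
  have vv: "v \<bullet> v = 1" "v \<in> V" "norm v = 1"
    using v by (auto simp: norm_eq_sqrt_inner)
  have "w = 0"
  proof (rule ccontr)
    assume "w \<noteq> 0"
    then have pos: "0 < w \<bullet> w" by simp
    define d where "d = c * (w \<bullet> w) - ?q w"
    \<comment> \<open>first variation of the Rayleigh quotient at its maximum, in the direction \<open>w\<close>\<close>
    have *: "2 * t * (w \<bullet> w) \<le> t\<^sup>2 * d" for t
    proof -
      have "?q (v + t *\<^sub>R w) \<le> c * (norm (v + t *\<^sub>R w))\<^sup>2"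
        by (intro le subspace_add subspace_scale V wV vv)
      also have "(norm (v + t *\<^sub>R w))\<^sup>2 = 1 + 2 * t * (v \<bullet> w) + t\<^sup>2 * (w \<bullet> w)"
        unfolding power2_norm_eq_inner
        using vv by (simp add: inner_add_left inner_add_right
            inner_commute[of w v] power2_eq_square algebra_simps)
      also have "?q (v + t *\<^sub>R w) = c + 2 * t * ((A *v v) \<bullet> w) + t\<^sup>2 * ?q w"
        using symmetric_inner[OF A, of w v]
        by (simp add: matrix_vector_right_distrib matrix_vector_mult_scaleR inner_add_left
            inner_add_right inner_commute[of w "A *v v"] c_def power2_eq_square algebra_simps)
      finally have "2 * t * ((A *v v) \<bullet> w - c * (v \<bullet> w)) \<le> t\<^sup>2 * d"
        unfolding d_def by (simp add: algebra_simps)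
      moreover have "(A *v v) \<bullet> w - c * (v \<bullet> w) = w \<bullet> w"
        by (subst (3) w_def) (simp add: inner_diff_left)
      ultimately show ?thesis by simp
    qed
    show False
    proof (cases "d \<le> 0")
      case True
      then show False using *[of 1] pos by simp
    next
      case False
      \<comment> \<open>For this \<open>t\<close> the right side of the variation bound is
        \<open>t * (w \<bullet> w)\<close>, only half of the left side.\<close>
      define t where "t = (w \<bullet> w) / d"
      have "t > 0" "t * d = w \<bullet> w"
        using False pos by (simp_all add: t_def)
      then have "t\<^sup>2 * d = t * (w \<bullet> w)" "0 < t * (w \<bullet> w)"
        using pos by (simp_all add: power2_eq_square mult.assoc)
      then show False
        using *[of t] by simp
    qed
  qed
  then show thesis
    using that[of v c] vv by (simp add: w_def)
qed

text \<open>Take an orthonormal set of eigenvectors of greatest cardinality. Its orthogonal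
  complement is invariant under \<open>A\<close>, so if it were nonzero it would contain a further
  eigenvector.\<close>

lemma symmetric_eigenbasis:
  fixes A :: "real ^ 'n ^ 'n"
  assumes A: "transpose A = A"
  obtains B where "finite B" "pairwise orthogonal B" "\<And>b. b \<in> B \<Longrightarrow> norm b = 1" "span B = UNIV"
    "\<And>b. b \<in> B \<Longrightarrow> A *v b = ((A *v b) \<bullet> b) *\<^sub>R b"
proof -
  define P where "P B \<longleftrightarrow> pairwise orthogonal B \<and> (\<forall>b\<in>B. norm b = 1 \<and> (\<exists>c. A *v b = c *\<^sub>R b))"
    for B
  \<comment> \<open>Orthonormal vectors are independent, so the dimension bounds the cardinality and
    a largest set exists.\<close>
  have fin: "finite B \<and> card B \<le> DIM(real ^ 'n)" if "P B" for B
    using pairwise_orthogonal_independent[of B] that independent_bound[of B]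
    by (fastforce simp: P_def)
  have "P {}"
    by (simp add: P_def)
  then obtain B where B: "P B" "\<And>B'. P B' \<Longrightarrow> card B' \<le> card B"
    using ex_has_greatest_nat[of P "{}" card "Suc DIM(real ^ 'n)"] fin
    by (auto simp: less_Suc_eq_le)
  define V where "V = {x. \<forall>b\<in>B. orthogonal b x}"
  have V: "subspace V"
    unfolding V_def by (auto simp: subspace_def orthogonal_def inner_add_right)
  have "V = {0}"
  proof (rule ccontr)
    assume "V \<noteq> {0}"
    have "A *v x \<in> V" if "x \<in> V" for x
      unfolding V_def
    proof (intro CollectI ballI)
      fix b assume b: "b \<in> B"
      then obtain c where "A *v b = c *\<^sub>R b"
        using B(1) by (auto simp: P_def)
      then show "orthogonal b (A *v x)"
        using that b symmetric_inner[OF A, of b x] by (simp add: V_def orthogonal_def)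
    qed
    then obtain v c where v: "v \<in> V" "norm v = 1" "A *v v = c *\<^sub>R v"
      using symmetric_eigenvector[OF A V \<open>V \<noteq> {0}\<close>] by metis
    then have "v \<notin> B"
      by (auto simp: V_def orthogonal_def)
    moreover have "P (insert v B)"
      using B(1) v by (auto simp: P_def pairwise_insert V_def orthogonal_commute)
    ultimately show False
      using B fin[of B] by (fastforce dest: B(2))
  qed
  have "span B = UNIV"
  proof (rule ccontr)
    assume "span B \<noteq> UNIV"
    then obtain a where "a \<noteq> 0" "\<forall>x\<in>span B. a \<bullet> x = 0"
      using span_not_univ_subset_hyperplane[of B] by auto
    then have "a \<in> V"
      by (auto simp: V_def orthogonal_def inner_commute span_base)
    then show False
      using \<open>V = {0}\<close> \<open>a \<noteq> 0\<close> by simp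
  qed
  moreover have "A *v b = ((A *v b) \<bullet> b) *\<^sub>R b" if "b \<in> B" for b
    using B(1) that by (auto simp: P_def norm_eq_sqrt_inner)
  ultimately show thesis
    using that[of B] B(1) fin[of B] by (auto simp: P_def)
qed

text \<open>The vector \<open>v\<close> minimizes the nonnegative form, so the first variation
  there, in the direction \<open>S *v v\<close>, has to vanish.\<close>

lemma psd_kernel:
  fixes S :: "real ^ 'n ^ 'n"
  assumes S: "transpose S = S" "\<And>x. 0 \<le> (S *v x) \<bullet> x" and v: "(S *v v) \<bullet> v = 0"
  shows "S *v v = 0"
proof (rule ccontr)
  assume "S *v v \<noteq> 0"
  let ?w = "S *v v"
  define d where "d = (S *v ?w) \<bullet> ?w"
  have w: "0 < ?w \<bullet> ?w"
    using \<open>S *v v \<noteq> 0\<close> by simp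
  have *: "0 \<le> 2 * t * (?w \<bullet> ?w) + t\<^sup>2 * d" for t
  proof -
    have "(S *v (v + t *\<^sub>R ?w)) \<bullet> (v + t *\<^sub>R ?w) = 2 * t * (?w \<bullet> ?w) + t\<^sup>2 * d"
      using v symmetric_inner[OF S(1), of ?w v]
      by (simp add: matrix_vector_right_distrib matrix_vector_mult_scaleR inner_add_left
            inner_add_right d_def power2_eq_square algebra_simps)
    then show ?thesis
      using S(2)[of "v + t *\<^sub>R ?w"] by simp
  qed
  have d: "0 \<le> d"
    using S(2)[of ?w] by (simp add: d_def)
  \<comment> \<open>The step is short enough for the quadratic term to be at most half of the linear
    one; \<open>d + 1\<close> keeps the denominator positive when \<open>d = 0\<close>.\<close>
  define t where "t = (?w \<bullet> ?w) / (d + 1)"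
  have t: "0 < t" "t * d \<le> ?w \<bullet> ?w"
    using d w by (auto simp: t_def field_simps)
  then have "t * (t * d) \<le> t * (?w \<bullet> ?w)" "0 < t * (?w \<bullet> ?w)"
    using w by (auto intro: mult_left_mono)
  then show False
    using *[of "- t"] by (simp add: power2_eq_square)
qed

lemma trace_eq_sum_quadratic: "trace A = (\<Sum>i\<in>UNIV. (A *v axis i 1) \<bullet> axis i 1)"
  for A :: "real ^ 'n ^ 'n"
  by (simp add: trace_def inner_axis matrix_vector_mult_basis column_def)

text \<open>With \<open>D = S - T\<close>, the traces of \<open>D S D\<close> and
  \<open>D T D\<close> are nonnegative and add up to 0, so both vanish. Uniqueness is needed because
  \<open>psd_sqrt\<close> is a definite description.\<close>

lemma psd_sqrt_unique:
  fixes S T :: "real ^ 'n ^ 'n"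
  assumes S: "transpose S = S" "\<And>x. 0 \<le> (S *v x) \<bullet> x"
    and T: "transpose T = T" "\<And>x. 0 \<le> (T *v x) \<bullet> x"
    and eq: "S ** S = T ** T"
  shows "S = T"
proof -
  define D where "D = S - T"
  have D: "transpose D = D"
    using S(1) T(1) unfolding D_def by (simp add: transpose_def vec_eq_iff)
  have sym: "(D ** (R ** D) *v x) \<bullet> x = (R *v (D *v x)) \<bullet> (D *v x)" for R x
    using symmetric_inner[OF D] by (simp add: matrix_vector_mul_assoc[symmetric])
  have sub: "A ** (B - C) = A ** B - A ** C" "(B - C) ** A = B ** A - C ** A"
    for A B C :: "real ^ 'n ^ 'n"
    by (simp_all add: matrix_eq matrix_vector_mul_assoc[symmetric] matrix_vector_mult_diff_distrib
        matrix_vector_mult_diff_rdistrib)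
  \<comment> \<open>Both sides equal \<open>T ** T - S ** T\<close>, because the squares
    agree.\<close>
  have "S ** D = - (D ** T)"
    unfolding D_def sub using eq by simp
  then have "trace (D ** (S ** D)) = - trace (D ** (D ** T))"
    by (simp add: trace_def matrix_matrix_mult_def sum_negf)
  also have "trace (D ** (D ** T)) = trace (D ** (T ** D))"
    by (subst trace_mul_sym) (simp only: matrix_mul_assoc)
  finally have tr: "(\<Sum>i\<in>UNIV. (S *v (D *v axis i 1)) \<bullet> (D *v axis i 1))
      + (\<Sum>i\<in>UNIV. (T *v (D *v axis i 1)) \<bullet> (D *v axis i 1)) = 0"
    by (simp add: trace_eq_sum_quadratic sym)
  then have "(\<Sum>i\<in>UNIV. (S *v (D *v axis i 1)) \<bullet> (D *v axis i 1)) = 0"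
    "(\<Sum>i\<in>UNIV. (T *v (D *v axis i 1)) \<bullet> (D *v axis i 1)) = 0"
    using sum_nonneg[of UNIV "\<lambda>i. (S *v (D *v axis i 1)) \<bullet> (D *v axis i 1)", OF S(2)]
      sum_nonneg[of UNIV "\<lambda>i. (T *v (D *v axis i 1)) \<bullet> (D *v axis i 1)", OF T(2)]
    by linarith+
  then have "(S *v (D *v axis i 1)) \<bullet> (D *v axis i 1) = 0"
    "(T *v (D *v axis i 1)) \<bullet> (D *v axis i 1) = 0" for i
    using S(2) T(2) by (simp_all add: sum_nonneg_eq_0_iff)
  \<comment> \<open>Vanishing of a nonnegative form puts the vector in the kernel. Subtracting the
    two equations gives \<open>D\<close> squared equal to 0, and a symmetric matrix with zero square
    is zero.\<close>
  then have "S *v (D *v axis i 1) = 0" "T *v (D *v axis i 1) = 0" for i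
    using psd_kernel[OF S] psd_kernel[OF T] by blast+
  then have "D *v (D *v axis i 1) = 0" for i
    by (simp add: D_def matrix_vector_mult_diff_rdistrib)
  then have "(D *v axis i 1) \<bullet> (D *v axis i 1) = 0" for i
    using symmetric_inner[OF D, of "axis i 1" "D *v axis i 1"] by simp
  then have "D *v axis i 1 = 0" for i
    by simp
  then have "D = 0"
    by (simp add: matrix_vector_mult_basis column_def vec_eq_iff)
  then show ?thesis
    by (simp add: D_def)
qed

text \<open>Spectral calculus: replace each eigenvalue by its square root on an orthonormal
  eigenbasis, then compare the square with \<open>A\<close> on that basis.\<close>

lemma psd_sqrt_exists:
  fixes A :: "real ^ 'n ^ 'n"
  assumes A: "transpose A = A" "\<And>x. 0 \<le> (A *v x) \<bullet> x"
  obtains S where "transpose S = S" "\<And>x. 0 \<le> (S *v x) \<bullet> x" "S ** S = A"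
proof -
  obtain B where B: "finite B" "pairwise orthogonal B" "\<And>b. b \<in> B \<Longrightarrow> norm b = 1" "span B = UNIV"
    and eig: "\<And>b. b \<in> B \<Longrightarrow> A *v b = ((A *v b) \<bullet> b) *\<^sub>R b"
    using symmetric_eigenbasis[OF A(1)] by metis
  define r where "r b = sqrt ((A *v b) \<bullet> b)" for b
  define S where "S = (\<Sum>b\<in>B. r b *\<^sub>R outer b)"
  have S: "S *v x = (\<Sum>b\<in>B. (r b * (b \<bullet> x)) *\<^sub>R b)" for x
    unfolding S_def using B(1)
    by (induction B rule: finite_induct)
      (auto simp: matrix_vector_mult_add_rdistrib outer_mult scaleR_matrix_vector_assoc[symmetric])
  have Sb: "S *v b = r b *\<^sub>R b" if b: "b \<in> B" for b
  proof -
    have "S *v b = (\<Sum>b'\<in>B. if b' = b then r b *\<^sub>R b else 0)"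
      unfolding S using B(2,3) b
      by (intro sum.cong) (auto simp: pairwise_def orthogonal_def norm_eq_1)
    then show ?thesis
      using B(1) b by simp
  qed
  have "transpose S = S"
    by (simp add: S_def transpose_def vec_eq_iff outer_def mult_ac)
  moreover have "0 \<le> (S *v x) \<bullet> x" for x
    using A(2) by (auto simp: S inner_sum_left r_def mult.assoc intro!: sum_nonneg)
  moreover have "S ** S = A"
  proof -
    have "S *v (S *v b) = A *v b" if "b \<in> B" for b
    proof -
      have "S *v (S *v b) = (r b)\<^sup>2 *\<^sub>R b"
        using that by (simp add: Sb matrix_vector_mult_scaleR power2_eq_square)
      also have "(r b)\<^sup>2 = (A *v b) \<bullet> b"
        using A(2) by (simp add: r_def)
      finally show ?thesis
        using eig[OF that] by simp
    qed
    then have "(S ** S) *v x = A *v x" if "x \<in> span B" for x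
      using that by (intro linear_eq_on[of "(*v) (S ** S)" "(*v) A" x B])
        (auto simp: matrix_vector_mul_assoc)
    then show ?thesis
      by (simp add: matrix_eq B(4))
  qed
  ultimately show thesis
    by (rule that)
qed

lemma psd_sqrt_square:
  fixes A :: "real ^ 'n ^ 'n"
  assumes A: "transpose A = A" "\<And>x. 0 \<le> (A *v x) \<bullet> x"
  shows "psd_sqrt A ** psd_sqrt A = A"
proof -
  obtain S where S: "transpose S = S" "\<And>x. 0 \<le> (S *v x) \<bullet> x" "S ** S = A"
    using psd_sqrt_exists[OF A] by metis
  then have "psd_sqrt A = S"
    unfolding psd_sqrt_def
    by (intro the_equality) (auto intro: psd_sqrt_unique)
  then show ?thesis
    using S by simp
qed

subsection \<open>Measurability and second moments\<close>

lemma continuous_on_det: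
  "continuous_on S f \<Longrightarrow> continuous_on S (\<lambda>x. det (f x :: real ^ 'n ^ 'n))"
  unfolding det_def by (intro continuous_intros)

text \<open>Cramer's rule exhibits the entries of the inverse as quotients of polynomials, hence as
  continuous functions where the determinant is nonzero.\<close>

lemma matrix_inv_eq_cramer:
  fixes A :: "real ^ 'n ^ 'n"
  assumes "invertible A"
  shows "matrix_inv A
    = (\<chi> k l. det (\<chi> i j. if j = k then axis l 1 $ i else A $ i $ j) / det A)"
proof -
  have "matrix_inv A *v axis l 1
      = (\<chi> k. det (\<chi> i j. if j = k then axis l 1 $ i else A $ i $ j) / det A)" for l
    using matrix_inv_vector_cancel[OF assms, of "axis l 1"] cramer assms invertible_det_nz
    by blast
  then show ?thesis
    by (simp add: matrix_vector_mult_basis column_def vec_eq_iff)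
qed

text \<open>On singular matrices \<open>matrix_inv\<close> is the choice from an empty predicate, hence constant.\<close>

lemma borel_measurable_matrix_inv [measurable]:
  "(matrix_inv :: real ^ 'n ^ 'n \<Rightarrow> _) \<in> borel_measurable borel"
proof -
  let ?S = "{A :: real ^ 'n ^ 'n. det A \<noteq> 0}"
  let ?f = "\<lambda>A :: real ^ 'n ^ 'n.
    \<chi> k l. det (\<chi> i j. if j = k then axis l 1 $ i else A $ i $ j) / det A"
  let ?c = "(SOME A'. False) :: real ^ 'n ^ 'n"
  have "open ?S"
    by (intro open_Collect_neq continuous_on_det continuous_intros)
  moreover have "continuous_on ?S ?f"
  proof -
    have "continuous_on ?S (\<lambda>A. (if j = k then axis l 1 $ i else A $ i $ j))" for i j k l
      by (cases "j = k") (auto intro!: continuous_intros)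
    then show ?thesis
      by (intro continuous_on_vec_lambda continuous_on_divide continuous_on_det)
        (auto intro: continuous_intros)
  qed
  ultimately have "(\<lambda>A. if A \<in> ?S then ?f A else ?c) \<in> borel_measurable borel"
    by (intro borel_measurable_continuous_on_if) (auto intro: continuous_intros)
  moreover have "(\<lambda>A. if A \<in> ?S then ?f A else ?c) = matrix_inv"
  proof
    fix A :: "real ^ 'n ^ 'n"
    show "(if A \<in> ?S then ?f A else ?c) = matrix_inv A"
    proof (cases "A \<in> ?S")
      case True
      then show ?thesis
        using matrix_inv_eq_cramer[of A] by (simp add: invertible_det_nz)
    next
      case False
      then have "(\<lambda>A'. A ** A' = mat 1 \<and> A' ** A = mat 1) = (\<lambda>_. False)"
        using invertible_det_nz[of A] by (auto simp: invertible_def fun_eq_iff)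
      with False show ?thesis
        by (simp add: matrix_inv_def)
    qed
  qed
  ultimately show ?thesis
    by simp
qed

lemma borel_measurable_matrix_vector_mult [measurable (raw)]:
  fixes A :: "'a \<Rightarrow> real ^ 'n ^ 'm"
  assumes "A \<in> borel_measurable N" "v \<in> borel_measurable N"
  shows "(\<lambda>w. A w *v v w) \<in> borel_measurable N"
  using assms
  by (rule borel_measurable_continuous_Pair)
    (auto simp: matrix_vector_mult_def intro!: continuous_on_vec_lambda continuous_intros)

lemma borel_measurable_outer [measurable (raw)]:
  "x \<in> borel_measurable N \<Longrightarrow> (\<lambda>w. outer (x w)) \<in> borel_measurable N"
  by (erule borel_measurable_continuous_on[rotated])
    (auto simp: outer_def intro!: continuous_on_vec_lambda continuous_intros)

lemma borel_measurable_gram: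
  assumes "\<And>j. j \<in> J \<Longrightarrow> (\<lambda>w. xs w j) \<in> borel_measurable N"
  shows "(\<lambda>w. gram J (xs w)) \<in> borel_measurable N"
  unfolding gram_def using assms by measurable

lemma borel_measurable_least_squares:
  assumes xs: "\<And>j. j \<in> J \<Longrightarrow> (\<lambda>w. xs w j) \<in> borel_measurable N"
    and ys: "\<And>j. j \<in> J \<Longrightarrow> (\<lambda>w. ys w j) \<in> borel_measurable N"
  shows "(\<lambda>w. least_squares J (xs w) (ys w)) \<in> borel_measurable N"
proof -
  note borel_measurable_gram[OF xs, measurable]
  show ?thesis
    unfolding least_squares_def using assms by measurable
qed

lemma borel_measurable_leverage:
  assumes xs: "\<And>j. j \<in> J \<Longrightarrow> (\<lambda>w. xs w j) \<in> borel_measurable N"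
    and x: "x \<in> borel_measurable N"
  shows "(\<lambda>w. leverage J (xs w) (x w)) \<in> borel_measurable N"
proof -
  note borel_measurable_gram[OF xs, measurable] x[measurable]
  show ?thesis
    unfolding leverage_def by measurable
qed

section \<open>Second moment matrices and whitening\<close>

lemma norm_outer: "norm (outer x) = (norm x)\<^sup>2"
proof -
  have "outer x \<bullet> outer x = (x \<bullet> x) * (x \<bullet> x)"
    by (simp add: inner_vec_def outer_def sum_product mult_ac)
  then show ?thesis
    by (simp add: norm_eq_sqrt_inner)
qed

lemma trace_mult_outer: "trace (B ** outer x) = (B *v x) \<bullet> x"
  by (simp add: trace_def matrix_matrix_mult_def outer_def matrix_vector_mult_def inner_vec_def
      sum_distrib_left sum_distrib_right mult_ac)

text \<open>A linear functional in finite dimension is bounded and so commutes with the integral. It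
  is applied to matrix entries, to quadratic forms and to traces of products.\<close>

lemma integral_outer:
  fixes X :: "'w \<Rightarrow> real ^ 'd" and \<phi> :: "real ^ 'd ^ 'd \<Rightarrow> real"
  assumes X: "X \<in> borel_measurable M" "integrable M (\<lambda>\<omega>. (norm (X \<omega>))\<^sup>2)"
    and \<phi>: "linear \<phi>"
  shows "integrable M (\<lambda>\<omega>. \<phi> (outer (X \<omega>)))"
    and "\<phi> (\<integral>\<omega>. outer (X \<omega>) \<partial>M) = (\<integral>\<omega>. \<phi> (outer (X \<omega>)) \<partial>M)"
proof -
  have int: "integrable M (\<lambda>\<omega>. outer (X \<omega>))"
    using X(2) by (rule Bochner_Integration.integrable_bound) (use X(1) in \<open>auto simp: norm_outer\<close>)
  have "bounded_linear \<phi>"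
    using \<phi> linear_conv_bounded_linear by blast
  from integrable_bounded_linear[OF this int] integral_bounded_linear[OF this int]
  show "integrable M (\<lambda>\<omega>. \<phi> (outer (X \<omega>)))"
    "\<phi> (\<integral>\<omega>. outer (X \<omega>) \<partial>M) = (\<integral>\<omega>. \<phi> (outer (X \<omega>)) \<partial>M)"
    by simp_all
qed

lemma integral_outer_psd:
  fixes X :: "'w \<Rightarrow> real ^ 'd"
  assumes X: "X \<in> borel_measurable M" "integrable M (\<lambda>\<omega>. (norm (X \<omega>))\<^sup>2)"
  defines "\<Sigma> \<equiv> \<integral>\<omega>. outer (X \<omega>) \<partial>M"
  shows "transpose \<Sigma> = \<Sigma>" and "0 \<le> (\<Sigma> *v v) \<bullet> v"
proof -
  have "\<Sigma> $ i $ j = (\<integral>\<omega>. outer (X \<omega>) $ i $ j \<partial>M)" for i j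
    unfolding \<Sigma>_def by (rule integral_outer(2)[OF X]) (auto intro!: linearI)
  then show "transpose \<Sigma> = \<Sigma>"
    by (simp add: transpose_def vec_eq_iff outer_def mult.commute)
  have "(\<Sigma> *v v) \<bullet> v = (\<integral>\<omega>. (outer (X \<omega>) *v v) \<bullet> v \<partial>M)"
    unfolding \<Sigma>_def
    by (rule integral_outer(2)[OF X])
      (auto intro!: linearI simp: matrix_vector_mult_add_rdistrib inner_add_left
        scaleR_matrix_vector_assoc[symmetric])
  also have "\<dots> \<ge> 0"
    by (simp add: outer_mult)
  finally show "0 \<le> (\<Sigma> *v v) \<bullet> v" .
qed

text \<open>Let \<open>?R\<close> be the inverse of the square root of the inverse of
  \<open>\<Sigma>\<close>. The whitened matrix has inverse
  \<open>?R ** (matrix_inv A ** ?R)\<close>, and since \<open>?R ** ?R = \<Sigma>\<close> cyclicity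
  of the trace gives the claim.\<close>

lemma trace_matrix_inv_whiten:
  fixes \<Sigma> A :: "real ^ 'd ^ 'd"
  assumes \<Sigma>: "transpose \<Sigma> = \<Sigma>" "\<And>v. 0 \<le> (\<Sigma> *v v) \<bullet> v" "invertible \<Sigma>" and A: "invertible A"
  shows "trace (matrix_inv (whiten \<Sigma> A)) = trace (matrix_inv A ** \<Sigma>)"
proof -
  let ?T = "matrix_inv \<Sigma>" and ?S = "psd_sqrt (matrix_inv \<Sigma>)"
  have "\<Sigma> ** transpose ?T = mat 1"
    using matrix_inv_left[OF \<Sigma>(3)] \<Sigma>(1) matrix_transpose_mul[of ?T \<Sigma>] by simp
  then have "transpose ?T = ?T"
    using matrix_inv_eqI by metis
  moreover have "0 \<le> (?T *v v) \<bullet> v" for v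
    using \<Sigma>(2)[of "?T *v v"] by (simp add: matrix_inv_vector_cancel[OF \<Sigma>(3)] inner_commute)
  ultimately have S: "?S ** ?S = ?T"
    by (rule psd_sqrt_square)
  then have "?S ** (?S ** \<Sigma>) = mat 1"
    by (simp add: matrix_mul_assoc matrix_inv_left[OF \<Sigma>(3)])
  then have R: "invertible ?S" "?S ** \<Sigma> = matrix_inv ?S"
    using invertible_right_inverse matrix_inv_eqI by metis+
  let ?R = "matrix_inv ?S"
  have RR: "?R ** ?R = \<Sigma>"
    unfolding R(2)[symmetric] by (metis R matrix_inv_left matrix_mul_assoc matrix_mul_lid)
  have "whiten \<Sigma> A ** (?R ** (matrix_inv A ** ?R)) = ?S ** (A ** ((?S ** ?R) ** (matrix_inv A ** ?R)))"
    by (simp add: whiten_def matrix_mul_assoc)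
  also have "\<dots> = ?S ** ((A ** matrix_inv A) ** ?R)"
    by (simp add: matrix_inv_right[OF R(1)] matrix_mul_assoc)
  also have "\<dots> = mat 1"
    by (simp add: matrix_inv_right[OF R(1)] matrix_inv_right[OF A])
  finally have "matrix_inv (whiten \<Sigma> A) = ?R ** (matrix_inv A ** ?R)"
    by (rule matrix_inv_eqI)
  then have "trace (matrix_inv (whiten \<Sigma> A)) = trace ((matrix_inv A ** ?R) ** ?R)"
    by (simp only: trace_mul_sym[of ?R])
  then show ?thesis
    by (simp add: matrix_mul_assoc[symmetric] RR)
qed

subsection \<open>Independence, exchangeability and extended expectations\<close>

lemma (in prob_space) distr_restrict_iid:
  assumes "indep_vars (\<lambda>_. N) Z I" "I \<noteq> {}" and "\<And>i. i \<in> I \<Longrightarrow> distr M N (Z i) = P"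
  shows "distr M (PiM I (\<lambda>_. N)) (\<lambda>\<omega>. \<lambda>i\<in>I. Z i \<omega>) = PiM I (\<lambda>_. P)"
proof -
  have "\<And>i. i \<in> I \<Longrightarrow> random_variable N (Z i)"
    using assms(1) by (auto simp: indep_vars_def)
  then have "distr M (PiM I (\<lambda>_. N)) (\<lambda>\<omega>. \<lambda>i\<in>I. Z i \<omega>) = PiM I (\<lambda>i. distr M N (Z i))"
    using assms indep_vars_iff_distr_eq_PiM'[where I = I and M' = "\<lambda>_. N" and X = Z] by simp
  also have "\<dots> = PiM I (\<lambda>_. P)"
    using assms(3) by (intro PiM_cong) auto
  finally show ?thesis .
qed

text \<open>The joint law is a product of copies of one law, and such a product is invariant under
  permuting coordinates.\<close>

lemma (in prob_space) nn_integral_iid_permute: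
  assumes Z: "indep_vars (\<lambda>_. N) Z I" "\<And>i. i \<in> I \<Longrightarrow> distr M N (Z i) = P"
    and \<pi>: "\<pi> permutes I" and I: "I \<noteq> {}"
    and G: "G \<in> borel_measurable (PiM I (\<lambda>_. N))"
  shows "(\<integral>\<^sup>+\<omega>. G (\<lambda>i\<in>I. Z (\<pi> i) \<omega>) \<partial>M) = (\<integral>\<^sup>+\<omega>. G (\<lambda>i\<in>I. Z i \<omega>) \<partial>M)"
proof -
  let ?N = "PiM I (\<lambda>_. N)" and ?Z = "\<lambda>\<omega>. \<lambda>i\<in>I. Z i \<omega>" and ?t = "\<lambda>z. \<lambda>i\<in>I. z (\<pi> i)"
  have rv: "random_variable N (Z i)" if "i \<in> I" for i
    using Z(1) that by (auto simp: indep_vars_def)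
  have \<pi>I: "\<pi> i \<in> I" if "i \<in> I" for i
    using \<pi> that by (simp add: permutes_in_image)
  have mZ: "?Z \<in> M \<rightarrow>\<^sub>M ?N"
    using rv by (rule measurable_restrict)
  have mt: "?t \<in> ?N \<rightarrow>\<^sub>M ?N"
    using \<pi>I by (intro measurable_restrict measurable_component_singleton)
  have law: "distr M ?N ?Z = PiM I (\<lambda>_. P)"
    by (rule distr_restrict_iid[OF Z(1) I Z(2)])
  obtain i where i: "i \<in> I" using I by blast
  have P: "prob_space P"
    using prob_space_distr[OF rv[OF i]] Z(2)[OF i] by simp
  have sets: "sets P = sets N"
    using Z(2)[OF i] by (metis sets_distr)
  then have sets': "sets (PiM I (\<lambda>_. P)) = sets ?N"
    by (intro sets_PiM_cong) auto
  have "distr (PiM I (\<lambda>_. P)) (PiM I (\<lambda>_. P)) ?t = PiM I (\<lambda>_. P)"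
    using \<pi> \<pi>I P by (intro distr_PiM_reindex) (auto simp: permutes_inj_on)
  then have t: "distr (PiM I (\<lambda>_. P)) ?N ?t = PiM I (\<lambda>_. P)"
    using sets' by (simp cong: distr_cong)
  have "(\<integral>\<^sup>+\<omega>. G (\<lambda>i\<in>I. Z (\<pi> i) \<omega>) \<partial>M) = (\<integral>\<^sup>+\<omega>. G (?t (?Z \<omega>)) \<partial>M)"
    using \<pi>I by (intro nn_integral_cong arg_cong[of _ _ G]) (auto simp: restrict_def)
  also have "\<dots> = (\<integral>\<^sup>+z. G (?t z) \<partial>distr M ?N ?Z)"
    using mZ mt G by (subst nn_integral_distr) auto
  also have "\<dots> = (\<integral>\<^sup>+z. G z \<partial>distr (PiM I (\<lambda>_. P)) ?N ?t)"
    using mt G measurable_cong_sets[OF sets' refl] unfolding law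
    by (subst nn_integral_distr) auto
  also have "\<dots> = (\<integral>\<^sup>+\<omega>. G (?Z \<omega>) \<partial>M)"
    unfolding t unfolding law[symmetric] using mZ G by (subst nn_integral_distr) auto
  finally show ?thesis .
qed

text \<open>Fubini's theorem for the product law, with coordinate \<open>k\<close> redrawn from its
  own copy of \<open>M\<close>. This identifies the expected risk, where the test point is drawn
  separately from the sample, with an expectation over the joint family.\<close>

lemma (in prob_space) nn_integral_indep_split:
  assumes Z: "indep_vars (\<lambda>_. N) Z (insert k I)" and I: "finite I" "I \<noteq> {}" "k \<notin> I"
    and G: "G \<in> borel_measurable (PiM (insert k I) (\<lambda>_. N))"
  shows "(\<lambda>\<omega>. \<integral>\<^sup>+\<omega>'. G ((\<lambda>i\<in>I. Z i \<omega>)(k := Z k \<omega>')) \<partial>M) \<in> borel_measurable M"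
    and "(\<integral>\<^sup>+\<omega>. G (\<lambda>i\<in>insert k I. Z i \<omega>) \<partial>M)
      = (\<integral>\<^sup>+\<omega>. \<integral>\<^sup>+\<omega>'. G ((\<lambda>i\<in>I. Z i \<omega>)(k := Z k \<omega>')) \<partial>M \<partial>M)"
proof -
  let ?K = "insert k I"
  \<comment> \<open>Outside the index set the law of \<open>Z k\<close> is a filler, so that every
    factor is a probability measure as \<open>product_sigma_finite\<close> requires.\<close>
  let ?Q = "\<lambda>i. distr M N (Z (if i \<in> ?K then i else k))"
  let ?g = "\<lambda>z. \<integral>\<^sup>+y. G (z(k := y)) \<partial>distr M N (Z k)"
  have rv: "random_variable N (Z i)" if "i \<in> ?K" for i
    using Z that by (auto simp: indep_vars_def)
  note rv[of k, simplified, measurable]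
  have prob: "prob_space (?Q i)" for i
    by (rule prob_space_distr) (auto intro: rv)
  interpret Q: product_sigma_finite ?Q
    using prob by (simp add: product_sigma_finite_def prob_space_imp_sigma_finite)
  interpret D: prob_space "distr M N (Z k)"
    by (rule prob_space_distr) (auto intro: rv)
  have law: "distr M (PiM J (\<lambda>_. N)) (\<lambda>\<omega>. \<lambda>i\<in>J. Z i \<omega>) = PiM J ?Q"
    if J: "J \<subseteq> ?K" "J \<noteq> {}" for J
  proof -
    have "distr M (PiM J (\<lambda>_. N)) (\<lambda>\<omega>. \<lambda>i\<in>J. Z i \<omega>) = PiM J (\<lambda>i. distr M N (Z i))"
      using indep_vars_subset[OF Z J(1)] indep_vars_iff_distr_eq_PiM'[where I = J and M' = "\<lambda>_. N" and X = Z] rv J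
      by auto
    also have "\<dots> = PiM J ?Q"
      using J by (intro PiM_cong) auto
    finally show ?thesis .
  qed
  have mZ [measurable]: "(\<lambda>\<omega>. \<lambda>i\<in>J. Z i \<omega>) \<in> M \<rightarrow>\<^sub>M PiM J (\<lambda>_. N)" if "J \<subseteq> ?K" for J
    using rv that by (intro measurable_restrict) auto
  have Gupd: "(\<lambda>(z, y). G (z(k := y))) \<in> borel_measurable (PiM I (\<lambda>_. N) \<Otimes>\<^sub>M distr M N (Z k))"
    using measurable_compose[OF measurable_add_dim[of k I "\<lambda>_. N"] G]
    by (simp add: split_beta' measurable_cong_sets[OF sets_pair_measure_cong[OF refl sets_distr] refl])
  then have mg: "?g \<in> borel_measurable (PiM I (\<lambda>_. N))"
    by (rule D.borel_measurable_nn_integral)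
  have inner: "?g (\<lambda>i\<in>I. Z i \<omega>) = (\<integral>\<^sup>+\<omega>'. G ((\<lambda>i\<in>I. Z i \<omega>)(k := Z k \<omega>')) \<partial>M)"
    if "\<omega> \<in> space M" for \<omega>
  proof (rule nn_integral_distr)
    have "(\<lambda>i\<in>I. Z i \<omega>) \<in> space (PiM I (\<lambda>_. N))"
      by (rule measurable_space[OF mZ that]) auto
    then show "(\<lambda>y. G ((\<lambda>i\<in>I. Z i \<omega>)(k := y))) \<in> borel_measurable (distr M N (Z k))"
      using measurable_Pair2[OF Gupd] by simp
  qed (auto intro: rv)
  have "(\<lambda>\<omega>. ?g (\<lambda>i\<in>I. Z i \<omega>)) \<in> borel_measurable M"
    by (rule measurable_compose[OF mZ mg]) auto
  then show "(\<lambda>\<omega>. \<integral>\<^sup>+\<omega>'. G ((\<lambda>i\<in>I. Z i \<omega>)(k := Z k \<omega>')) \<partial>M) \<in> borel_measurable M"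
    using inner by (simp cong: measurable_cong)
  have sQ: "sets (PiM ?K ?Q) = sets (PiM ?K (\<lambda>_. N))"
    by (intro sets_PiM_cong) auto
  have "(\<integral>\<^sup>+\<omega>. G (\<lambda>i\<in>?K. Z i \<omega>) \<partial>M) = (\<integral>\<^sup>+z. G z \<partial>PiM ?K ?Q)"
    unfolding law[OF order.refl insert_not_empty, symmetric]
    using G mZ[of ?K] by (subst nn_integral_distr) auto
  also have "\<dots> = (\<integral>\<^sup>+z. (\<integral>\<^sup>+y. G (z(k := y)) \<partial>?Q k) \<partial>PiM I ?Q)"
    using G I measurable_cong_sets[OF sQ refl] by (intro Q.product_nn_integral_insert) auto
  also have "\<dots> = (\<integral>\<^sup>+z. ?g z \<partial>distr M (PiM I (\<lambda>_. N)) (\<lambda>\<omega>. \<lambda>i\<in>I. Z i \<omega>))"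
    using I by (subst law) auto
  also have "\<dots> = (\<integral>\<^sup>+\<omega>. ?g (\<lambda>i\<in>I. Z i \<omega>) \<partial>M)"
    using mZ[OF subset_insertI] mg by (subst nn_integral_distr) auto
  also have "\<dots> = (\<integral>\<^sup>+\<omega>. \<integral>\<^sup>+\<omega>'. G ((\<lambda>i\<in>I. Z i \<omega>)(k := Z k \<omega>')) \<partial>M \<partial>M)"
    by (intro nn_integral_cong inner)
  finally show "(\<integral>\<^sup>+\<omega>. G (\<lambda>i\<in>?K. Z i \<omega>) \<partial>M)
      = (\<integral>\<^sup>+\<omega>. \<integral>\<^sup>+\<omega>'. G ((\<lambda>i\<in>I. Z i \<omega>)(k := Z k \<omega>')) \<partial>M \<partial>M)" .
qed

section \<open>Expectations with values in the extended reals\<close>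

lemma eexpectation_AE_nonneg:
  assumes "AE \<omega> in M. h \<omega> = ereal (u \<omega>) \<and> 0 \<le> u \<omega>"
  shows "eexpectation M h = enn2ereal (\<integral>\<^sup>+\<omega>. ennreal (u \<omega>) \<partial>M)"
proof -
  have "(\<integral>\<^sup>+\<omega>. e2ennreal (h \<omega>) \<partial>M) = (\<integral>\<^sup>+\<omega>. ennreal (u \<omega>) \<partial>M)"
    using assms by (intro nn_integral_cong_AE) auto
  moreover have "(\<integral>\<^sup>+\<omega>. e2ennreal (- h \<omega>) \<partial>M) = (\<integral>\<^sup>+\<omega>. 0 \<partial>M)"
    using assms by (intro nn_integral_cong_AE) (auto simp: ennreal_neg)
  ultimately show ?thesis
    by (simp add: eexpectation_def zero_ennreal.rep_eq)
qed

text \<open>The negative part of \<open>g - r\<close> is at most \<open>r\<close>, hence has finite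
  integral, so the difference of the two parts is meaningful even if \<open>g\<close> has infinite
  integral. Moving that part to the other side reduces the claim to the bound on the integral of
  \<open>g\<close>.\<close>

lemma (in prob_space) eexpectation_minus_const_le:
  assumes g: "AE \<omega> in M. h \<omega> = enn2ereal (g \<omega>) - ereal r" "g \<in> borel_measurable M" and r: "0 \<le> r"
    and le: "(\<integral>\<^sup>+\<omega>. g \<omega> \<partial>M) \<le> L + ennreal r"
  shows "eexpectation M h \<le> enn2ereal L"
proof -
  let ?p = "\<integral>\<^sup>+\<omega>. g \<omega> - ennreal r \<partial>M" and ?q = "\<integral>\<^sup>+\<omega>. ennreal r - g \<omega> \<partial>M"
  have "?q \<le> (\<integral>\<^sup>+\<omega>. ennreal r \<partial>M)"
    by (intro nn_integral_mono) (simp add: diff_le_self_ennreal)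
  then have q: "?q \<noteq> top"
    by (auto simp: emeasure_space_1 top_unique)
  \<comment> \<open>Subtraction in \<open>ennreal\<close> is truncated at 0, so the two differences
    are the positive and the negative part of \<open>g - r\<close>.\<close>
  have eq: "g \<omega> - ennreal r + ennreal r = g \<omega> + (ennreal r - g \<omega>)" for \<omega>
  proof (cases "g \<omega>")
    case (real x)
    then show ?thesis
      using r by (cases "r \<le> x") (auto simp: ennreal_minus ennreal_neg simp flip: ennreal_plus)
  qed (use r in simp)
  have "?p + ennreal r = (\<integral>\<^sup>+\<omega>. (g \<omega> - ennreal r) + ennreal r \<partial>M)"
    using g(2) by (subst nn_integral_add) (auto simp: emeasure_space_1)
  also have "\<dots> = (\<integral>\<^sup>+\<omega>. g \<omega> \<partial>M) + ?q"
    unfolding eq using g(2) by (intro nn_integral_add) auto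
  also have "\<dots> \<le> (L + ?q) + ennreal r"
    using le by (simp add: add.commute add.left_commute add_mono)
  finally have pq: "?p \<le> L + ?q"
    by (simp add: add.commute[of _ "ennreal r"] ennreal_add_left_cancel_le)
  have "AE \<omega> in M. e2ennreal (h \<omega>) = g \<omega> - ennreal r \<and> e2ennreal (- h \<omega>) = ennreal r - g \<omega>"
    using g(1)
  proof eventually_elim
    case (elim \<omega>)
    then have "- h \<omega> = ereal r - enn2ereal (g \<omega>)"
      by (cases "g \<omega>") auto
    then show ?case
      using elim r e2eenreal_enn2ereal_diff[of "g \<omega>" "ennreal r"]
        e2eenreal_enn2ereal_diff[of "ennreal r" "g \<omega>"] by simp
  qed
  then have "(\<integral>\<^sup>+\<omega>. e2ennreal (h \<omega>) \<partial>M) = ?p" "(\<integral>\<^sup>+\<omega>. e2ennreal (- h \<omega>) \<partial>M) = ?q"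
    by (auto intro!: nn_integral_cong_AE elim: eventually_mono)
  then have "eexpectation M h = enn2ereal ?p - enn2ereal ?q"
    by (simp add: eexpectation_def)
  moreover have "enn2ereal ?p \<le> enn2ereal L + enn2ereal ?q"
    using pq by (simp add: less_eq_ennreal.rep_eq plus_ennreal.rep_eq)
  ultimately show ?thesis
    using q enn2ereal_nonneg[of ?q] by (auto simp: ereal_minus_le_iff)
qed

text \<open>Jensen's inequality for the concave logarithm, by integrating its tangent at the mean.
  If the mean is infinite, so is the right side.\<close>

lemma (in prob_space) nn_integral_ln_le_elog:
  assumes h: "h \<in> borel_measurable M" "AE \<omega> in M. 0 \<le> h \<omega>"
  shows "enn2ereal (\<integral>\<^sup>+\<omega>. ennreal (ln (1 + h \<omega>)) \<partial>M) \<le> elog (1 + enn2ereal (\<integral>\<^sup>+\<omega>. ennreal (h \<omega>) \<partial>M))"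
proof (cases "(\<integral>\<^sup>+\<omega>. ennreal (h \<omega>) \<partial>M) = top")
  case True
  then show ?thesis
    by (simp add: elog_def)
next
  case False
  then have int: "integrable M h"
    using h by (intro integrableI_nonneg) (auto simp: less_top)
  define m where "m = expectation h"
  have m: "0 \<le> m" "(\<integral>\<^sup>+\<omega>. ennreal (h \<omega>) \<partial>M) = ennreal m"
    using h nn_integral_eq_integral[OF int] by (auto simp: m_def intro: integral_nonneg_AE)
  \<comment> \<open>the tangent of \<open>ln\<close> at \<open>1 + m\<close>\<close>
  have tangent: "ln (1 + x) \<le> ln (1 + m) + (x - m) / (1 + m)" if "0 \<le> x" for x
  proof -
    have "ln ((1 + x) / (1 + m)) \<le> (1 + x) / (1 + m) - 1"
      using that m by (intro ln_le_minus_one) auto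
    also have "\<dots> = (x - m) / (1 + m)"
      using m by (simp add: field_simps)
    finally show ?thesis
      using that m by (simp add: ln_div)
  qed
  have ln_int: "integrable M (\<lambda>\<omega>. ln (1 + h \<omega>))"
    using int
  proof (rule Bochner_Integration.integrable_bound)
    show "AE \<omega> in M. norm (ln (1 + h \<omega>)) \<le> norm (h \<omega>)"
      using h(2) by eventually_elim (auto intro: ln_add_one_self_le_self)
  qed (use h(1) in measurable)
  have "expectation (\<lambda>\<omega>. ln (1 + h \<omega>)) \<le> expectation (\<lambda>\<omega>. ln (1 + m) + (h \<omega> - m) / (1 + m))"
    using h(2) int ln_int
    by (intro integral_mono_AE) (auto intro: tangent elim!: AE_mp)
  also have "\<dots> = ln (1 + m)"
    using int by (simp add: m_def prob_space)
  finally have le: "expectation (\<lambda>\<omega>. ln (1 + h \<omega>)) \<le> ln (1 + m)" .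
  have "(\<integral>\<^sup>+\<omega>. ennreal (ln (1 + h \<omega>)) \<partial>M) = ennreal (expectation (\<lambda>\<omega>. ln (1 + h \<omega>)))"
    using h(2) by (intro nn_integral_eq_integral ln_int) (auto elim!: AE_mp)
  also have "\<dots> \<le> ennreal (ln (1 + m))"
    using le by (rule ennreal_leI)
  finally have "enn2ereal (\<integral>\<^sup>+\<omega>. ennreal (ln (1 + h \<omega>)) \<partial>M) \<le> enn2ereal (ennreal (ln (1 + m)))"
    by (simp add: less_eq_ennreal.rep_eq)
  also have "\<dots> = elog (1 + enn2ereal (\<integral>\<^sup>+\<omega>. ennreal (h \<omega>) \<partial>M))"
    using m by (simp add: elog_def one_ereal_def)
  finally show ?thesis .
qed

subsection \<open>The excess risk\<close>

text \<open>All points enter through one tuple \<open>z\<close> of pairs, so that this is a function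
  on the product space, to which exchangeability and Fubini's theorem apply.\<close>

definition residual :: "nat set \<Rightarrow> nat \<Rightarrow> (nat \<Rightarrow> (real ^ 'd) \<times> real) \<Rightarrow> real" where
  "residual J j z = snd (z j) - least_squares J (\<lambda>i. fst (z i)) (\<lambda>i. snd (z i)) \<bullet> fst (z j)"

definition lev :: "nat set \<Rightarrow> nat \<Rightarrow> (nat \<Rightarrow> (real ^ 'd) \<times> real) \<Rightarrow> real" where
  "lev J j z = leverage J (\<lambda>i. fst (z i)) (fst (z j))"

lemma residual_lev_cong:
  assumes "\<And>i. i \<in> J \<Longrightarrow> z i = z' i" "z j = z' j"
  shows "residual J j z = residual J j z'" "lev J j z = lev J j z'"
  using assms
  by (simp_all add: residual_def lev_def leverage_def least_squares_def gram_def cong: sum.cong)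

lemma borel_measurable_residual_lev:
  assumes "J \<subseteq> I" "j \<in> I"
  shows "residual J j \<in> borel_measurable (PiM I (\<lambda>_. borel :: ((real ^ 'd) \<times> real) measure))"
    and "lev J j \<in> borel_measurable (PiM I (\<lambda>_. borel :: ((real ^ 'd) \<times> real) measure))"
proof -
  let ?N = "PiM I (\<lambda>_. borel :: ((real ^ 'd) \<times> real) measure)"
  have comp: "(\<lambda>z. z i) \<in> ?N \<rightarrow>\<^sub>M borel" if "i \<in> I" for i
    using that by simp
  have x: "(\<lambda>z. fst (z i)) \<in> borel_measurable ?N" if "i \<in> I" for i
    using comp[OF that] by (rule borel_measurable_continuous_on[rotated]) (intro continuous_intros)
  have y: "(\<lambda>z. snd (z i)) \<in> borel_measurable ?N" if "i \<in> I" for i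
    using comp[OF that] by (rule borel_measurable_continuous_on[rotated]) (intro continuous_intros)
  have "(\<lambda>z. least_squares J (\<lambda>i. fst (z i)) (\<lambda>i. snd (z i))) \<in> borel_measurable ?N"
    using assms by (intro borel_measurable_least_squares x y) auto
  then show "residual J j \<in> borel_measurable ?N"
    unfolding residual_def[abs_def] using x y assms(2)
    by (intro borel_measurable_diff borel_measurable_inner) auto
  show "lev J j \<in> borel_measurable ?N"
    unfolding lev_def[abs_def] using assms by (intro borel_measurable_leverage x) auto
qed

lemma elog_gaussian:
  assumes "0 < s"
  shows "- elog (ereal (gaussian m (s\<^sup>2) y)) = ereal (ln s + ((y - m) / s)\<^sup>2 / 2)"
proof -
  have "gaussian m (s\<^sup>2) y = exp (- ((y - m) / s)\<^sup>2 / 2 - ln s)"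
    using assms by (simp add: gaussian_eq_exp exp_diff)
  then show ?thesis
    by (simp add: elog_exp)
qed

text \<open>The test point is index 0 and the sample is \<open>{1..n}\<close>, which makes the
  \<open>n + 1\<close> points a single i.i.d. family.\<close>

locale regression_sample = prob_space M for M :: "'w measure" +
  fixes Z :: "nat \<Rightarrow> 'w \<Rightarrow> (real ^ 'd) \<times> real" and n :: nat
  assumes indep: "indep_vars (\<lambda>_. borel) Z {0..n}"
    and ident: "\<And>i. i \<in> {1..n} \<Longrightarrow> distr M borel (Z i) = distr M borel (Z 0)"
    and square_X: "integrable M (\<lambda>\<omega>. (norm (fst (Z 0 \<omega>)))\<^sup>2)"
    and square_Y: "integrable M (\<lambda>\<omega>. (snd (Z 0 \<omega>))\<^sup>2)"
    and inv: "AE \<omega> in M. invertible (emp_cov n (\<lambda>i. fst (Z i \<omega>)))"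
begin

abbreviation "X \<omega> \<equiv> fst (Z 0 \<omega>)"
abbreviation "Y \<omega> \<equiv> snd (Z 0 \<omega>)"
abbreviation "xs \<omega> \<equiv> \<lambda>i. fst (Z i \<omega>)"
abbreviation "ys \<omega> \<equiv> \<lambda>i. snd (Z i \<omega>)"
abbreviation "joint \<omega> \<equiv> \<lambda>i\<in>{0..n}. Z i \<omega>"

text \<open>The sample comes from one outcome and the test point from another; integrating over the
  second gives the risk conditionally on the sample.\<close>

abbreviation "fresh \<omega> \<omega>' \<equiv> (\<lambda>i\<in>{1..n}. Z i \<omega>)(0 := Z 0 \<omega>')"
abbreviation "N \<equiv> PiM {0..n} (\<lambda>_. borel :: ((real ^ 'd) \<times> real) measure)"

text \<open>This keeps \<open>{1..n}\<close> from being rewritten to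
  \<open>{Suc 0..n}\<close>.\<close>

declare One_nat_def [simp del]

lemma atLeast0_atMost_n: "{0..n} = insert 0 {1..n}"
  by auto

lemma n_pos: "0 < n"
proof -
  have "AE \<omega> in M. 0 < n"
    using inv by eventually_elim (rule invertible_emp_cov(1))
  then show ?thesis
    by (simp add: AE_const)
qed

lemma rv: "i \<in> {0..n} \<Longrightarrow> Z i \<in> borel_measurable M"
  using indep by (auto simp: indep_vars_def)

lemma ident0: "i \<in> {0..n} \<Longrightarrow> distr M borel (Z i) = distr M borel (Z 0)"
  using ident[of i] by (cases "i = 0") auto

lemma rv_X: "X \<in> borel_measurable M"
  using rv[of 0, simplified] by (rule borel_measurable_continuous_on[rotated]) (intro continuous_intros)

lemma rv_joint: "joint \<in> M \<rightarrow>\<^sub>M N"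
  using rv by (rule measurable_restrict)

lemma inv_gram: "AE \<omega> in M. invertible (gram {1..n} (xs \<omega>)) \<and> invertible (gram {0..n} (xs \<omega>))"
  using inv
proof eventually_elim
  case (elim \<omega>)
  from invertible_emp_cov(2)[OF elim] show ?case
    using invertible_gram_mono[of "{0..n}" "{1..n}" "xs \<omega>"] by auto
qed

lemma residual_lev_joint:
  "j \<in> {0..n} \<Longrightarrow> residual {0..n} j (joint \<omega>)
    = ys \<omega> j - least_squares {0..n} (xs \<omega>) (ys \<omega>) \<bullet> xs \<omega> j"
  "residual {1..n} 0 (joint \<omega>) = Y \<omega> - least_squares {1..n} (xs \<omega>) (ys \<omega>) \<bullet> X \<omega>"
  "lev {1..n} 0 (joint \<omega>) = leverage {1..n} (xs \<omega>) (X \<omega>)"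
  using residual_lev_cong[of "{0..n}" "joint \<omega>" "\<lambda>i. Z i \<omega>" j]
    residual_lev_cong[of "{1..n}" "joint \<omega>" "\<lambda>i. Z i \<omega>" 0]
  by (simp_all add: residual_def lev_def)

lemma residual_lev_fresh:
  "residual {1..n} 0 (fresh \<omega> \<omega>') = Y \<omega>' - least_squares {1..n} (xs \<omega>) (ys \<omega>) \<bullet> X \<omega>'"
  "lev {1..n} 0 (fresh \<omega> \<omega>') = leverage {1..n} (xs \<omega>) (X \<omega>')"
  by (simp_all add: residual_def lev_def leverage_def least_squares_def gram_def
      cong: sum.cong_simp)

text \<open>By exchangeability, the loss of the least squares estimator trained on all \<open>n + 1\<close> points
  has the same expectation at each of them, so it can be averaged over the points before it is
  compared with the loss of a fixed parameter.\<close>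

lemma full_loss_le:
  "(\<integral>\<^sup>+\<omega>. ennreal ((residual {0..n} 0 (joint \<omega>))\<^sup>2 / 2) \<partial>M)
    \<le> (\<integral>\<^sup>+\<omega>. ennreal ((Y \<omega> - \<theta> \<bullet> X \<omega>)\<^sup>2 / 2) \<partial>M)"
proof -
  let ?H = "\<lambda>j z. ennreal ((residual {0..n} j z)\<^sup>2 / 2)"
  let ?D = "\<integral>\<^sup>+\<omega>. ?H 0 (joint \<omega>) \<partial>M"
  let ?l = "\<lambda>z :: (real ^ 'd) \<times> real. ennreal ((snd z - \<theta> \<bullet> fst z)\<^sup>2 / 2)"
  let ?R = "\<integral>\<^sup>+\<omega>. ?l (Z 0 \<omega>) \<partial>M"
  have mH: "?H j \<in> borel_measurable N" if "j \<in> {0..n}" for j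
    using borel_measurable_residual_lev(1)[of "{0..n}" "{0..n}" j] that by measurable
  have ml: "?l \<in> borel_measurable borel"
    by (intro measurable_compose[OF _ measurable_ennreal] borel_measurable_continuous_onI)
      (auto intro!: continuous_intros)
  have H: "(\<integral>\<^sup>+\<omega>. ?H j (joint \<omega>) \<partial>M) = ?D" if j: "j \<in> {0..n}" for j
  proof -
    let ?\<pi> = "Transposition.transpose 0 j"
    have \<pi>: "?\<pi> permutes {0..n}"
      using j by (intro permutes_swap_id) auto
    have perm: "(\<Sum>i\<in>{0..n}. f (?\<pi> i)) = (\<Sum>i\<in>{0..n}. f i)" for f :: "nat \<Rightarrow> 'z::comm_monoid_add"
      using sum.permute[OF \<pi>, of f] by (simp add: comp_def)
    \<comment> \<open>Swapping 0 and \<open>j\<close> preserves the sums that define the estimator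
      on all points and moves the residual from one point to the other.\<close>
    have "residual {0..n} 0 (\<lambda>i\<in>{0..n}. Z (?\<pi> i) \<omega>) = residual {0..n} j (joint \<omega>)" for \<omega>
    proof -
      have "residual {0..n} 0 (\<lambda>i\<in>{0..n}. Z (?\<pi> i) \<omega>) = residual {0..n} 0 (\<lambda>i. Z (?\<pi> i) \<omega>)"
        by (intro residual_lev_cong) auto
      also have "\<dots> = residual {0..n} j (\<lambda>i. Z i \<omega>)"
        using perm[of "\<lambda>i. outer (fst (Z i \<omega>))"] perm[of "\<lambda>i. snd (Z i \<omega>) *\<^sub>R fst (Z i \<omega>)"]
        by (simp add: residual_def least_squares_def gram_def)
      also have "\<dots> = residual {0..n} j (joint \<omega>)"
        unfolding residual_lev_joint(1)[OF j] by (simp only: residual_def)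
      finally show ?thesis .
    qed
    then show ?thesis
      using nn_integral_iid_permute[OF indep ident0 \<pi> _ mH[of 0]] by simp
  qed
  have R: "(\<integral>\<^sup>+\<omega>. ?l (Z j \<omega>) \<partial>M) = ?R" if j: "j \<in> {0..n}" for j
  proof -
    have "(\<integral>\<^sup>+\<omega>. ?l (Z j \<omega>) \<partial>M) = (\<integral>\<^sup>+z. ?l z \<partial>distr M borel (Z j))"
      by (rule nn_integral_distr[symmetric]) (use rv j ml in auto)
    also have "\<dots> = ?R"
      unfolding ident0[OF j] by (rule nn_integral_distr) (use rv ml in auto)
    finally show ?thesis .
  qed
  have "of_nat (Suc n) * ?D = (\<Sum>j\<in>{0..n}. ?D)"
    by (simp del: of_nat_Suc)
  also have "\<dots> = (\<Sum>j\<in>{0..n}. \<integral>\<^sup>+\<omega>. ?H j (joint \<omega>) \<partial>M)"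
    by (intro sum.cong refl H[symmetric])
  also have "\<dots> = (\<integral>\<^sup>+\<omega>. (\<Sum>j\<in>{0..n}. ?H j (joint \<omega>)) \<partial>M)"
    using measurable_compose[OF rv_joint mH] by (intro nn_integral_sum[symmetric]) auto
  also have "\<dots> \<le> (\<integral>\<^sup>+\<omega>. (\<Sum>j\<in>{0..n}. ?l (Z j \<omega>)) \<partial>M)"
  proof (rule nn_integral_mono_AE)
    show "AE \<omega> in M. (\<Sum>j\<in>{0..n}. ?H j (joint \<omega>)) \<le> (\<Sum>j\<in>{0..n}. ?l (Z j \<omega>))"
      using inv_gram
    proof eventually_elim
      case (elim \<omega>)
      have "(\<Sum>j\<in>{0..n}. (residual {0..n} j (joint \<omega>))\<^sup>2)
          \<le> (\<Sum>j\<in>{0..n}. (snd (Z j \<omega>) - \<theta> \<bullet> fst (Z j \<omega>))\<^sup>2)"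
        using least_squares_le[of "{0..n}" "xs \<omega>" "ys \<omega>" \<theta>] elim
        by (simp add: residual_lev_joint)
      then show ?case
        by (simp add: sum_ennreal flip: sum_divide_distrib) (auto intro!: ennreal_leI divide_right_mono)
    qed
  qed
  also have "\<dots> = (\<Sum>j\<in>{0..n}. \<integral>\<^sup>+\<omega>. ?l (Z j \<omega>) \<partial>M)"
    using measurable_compose[OF rv ml] by (intro nn_integral_sum) auto
  also have "\<dots> = (\<Sum>j\<in>{0..n}. ?R)"
    by (intro sum.cong refl R)
  also have "\<dots> = of_nat (Suc n) * ?R"
    by (simp del: of_nat_Suc)
  finally show ?thesis
    by (simp add: ennreal_mult_le_mult_iff del: of_nat_Suc)
qed

text \<open>This is minus the log density of a Gaussian centred at the least squares prediction,
  with standard deviation one plus the leverage.\<close>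

definition smp_loss :: "(nat \<Rightarrow> (real ^ 'd) \<times> real) \<Rightarrow> real" where
  "smp_loss z = ln (1 + lev {1..n} 0 z) + (residual {1..n} 0 z / (1 + lev {1..n} 0 z))\<^sup>2 / 2"

lemma measurable_smp_loss: "smp_loss \<in> borel_measurable N"
proof -
  note borel_measurable_residual_lev[of "{1..n}" "{0..n}" 0, measurable (raw)]
  show ?thesis
    unfolding smp_loss_def[abs_def] by measurable
qed

lemma lev_nonneg: "AE \<omega> in M. 0 \<le> lev {1..n} 0 (joint \<omega>)"
  using inv_gram by eventually_elim (simp add: residual_lev_joint leverage_nonneg)

text \<open>Dividing by one plus the leverage is exactly what turns the out-of-sample residual into
  the residual of the fit on all \<open>n + 1\<close> points.\<close>

lemma smp_loss_joint:
  "AE \<omega> in M. smp_loss (joint \<omega>)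
    = ln (1 + lev {1..n} 0 (joint \<omega>)) + (residual {0..n} 0 (joint \<omega>))\<^sup>2 / 2"
  using inv_gram
proof eventually_elim
  case (elim \<omega>)
  then have "residual {0..n} 0 (joint \<omega>) = residual {1..n} 0 (joint \<omega>) / (1 + lev {1..n} 0 (joint \<omega>))"
    using least_squares_insert(1)[of "{1..n}" 0 "xs \<omega>" "ys \<omega>"]
    by (simp add: residual_lev_joint flip: atLeast0_atMost_n)
  then show ?case
    by (simp add: smp_loss_def)
qed

text \<open>The leverage is nonnegative, so the logarithm and the whole loss are too, and the risk
  is a possibly infinite nonnegative integral.\<close>

lemma risk_sample_minmax:
  "AE \<omega> in M. risk M X Y (sample_minmax gaussian_linear n (xs \<omega>) (ys \<omega>))
    = enn2ereal (\<integral>\<^sup>+\<omega>'. ennreal (smp_loss (fresh \<omega> \<omega>')) \<partial>M)"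
  using inv
proof eventually_elim
  case (elim \<omega>)
  have "- elog (ereal (sample_minmax gaussian_linear n (xs \<omega>) (ys \<omega>) (X \<omega>') (Y \<omega>')))
      = ereal (smp_loss (fresh \<omega> \<omega>')) \<and> 0 \<le> smp_loss (fresh \<omega> \<omega>')" for \<omega>'
  proof -
    let ?h = "leverage {1..n} (xs \<omega>) (X \<omega>')"
    have h: "0 \<le> ?h"
      using invertible_emp_cov(2)[OF elim] by (rule leverage_nonneg)
    show ?thesis
      unfolding smp_loss_def residual_lev_fresh
      using h by (simp add: sample_minmax_gaussian_linear[OF elim] ols_eq_least_squares[OF elim]
          elog_gaussian)
  qed
  then show ?case
    unfolding risk_def by (intro eexpectation_AE_nonneg) auto
qed

lemma risk_gaussian_linear:
  "risk M X Y (gaussian_linear \<theta>) = enn2ereal (\<integral>\<^sup>+\<omega>. ennreal ((Y \<omega> - \<theta> \<bullet> X \<omega>)\<^sup>2 / 2) \<partial>M)"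
  unfolding risk_def
  by (intro eexpectation_AE_nonneg) (simp add: gaussian_linear_eq_exp elog_exp)

text \<open>The infimum is finite, since \<open>\<theta> = 0\<close> already has finite risk by the
  second moment of \<open>Y\<close>; hence the excess risk is never of the form infinity minus
  infinity. The bound by \<open>r\<close> holds because \<open>full_loss_le\<close> is uniform in
  \<open>\<theta>\<close>.\<close>

lemma Inf_risk:
  obtains r where "0 \<le> r" "(INF \<theta>. risk M X Y (gaussian_linear \<theta>)) = ereal r"
    "(\<integral>\<^sup>+\<omega>. ennreal ((residual {0..n} 0 (joint \<omega>))\<^sup>2 / 2) \<partial>M) \<le> ennreal r"
proof -
  let ?D = "\<integral>\<^sup>+\<omega>. ennreal ((residual {0..n} 0 (joint \<omega>))\<^sup>2 / 2) \<partial>M"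
  let ?I = "INF \<theta>. risk M X Y (gaussian_linear \<theta>)"
  have D: "enn2ereal ?D \<le> ?I"
    using full_loss_le by (auto simp: risk_gaussian_linear less_eq_ennreal.rep_eq[symmetric] intro!: INF_greatest)
  have "?I \<le> risk M X Y (gaussian_linear 0)"
    by (rule INF_lower) simp
  also have "\<dots> = enn2ereal (\<integral>\<^sup>+\<omega>. ennreal ((Y \<omega>)\<^sup>2 / 2) \<partial>M)"
    by (simp add: risk_gaussian_linear)
  also have "\<dots> = ereal (expectation (\<lambda>\<omega>. (Y \<omega>)\<^sup>2 / 2))"
    using square_Y by (subst nn_integral_eq_integral) auto
  finally have up: "?I \<le> ereal (expectation (\<lambda>\<omega>. (Y \<omega>)\<^sup>2 / 2))" .
  have "0 \<le> ?I"
    using D enn2ereal_nonneg order_trans by blast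
  then obtain r where r: "?I = ereal r" "0 \<le> r"
    using up by (cases ?I) auto
  have "?D \<le> ennreal r"
    using D r by (simp add: less_eq_ennreal.rep_eq)
  with r show thesis
    using that by blast
qed

text \<open>Fubini's theorem merges sample and test point; the joint loss then splits into the log
  leverage and the full least squares loss, and the latter is at most the infimum \<open>r\<close>
  being subtracted.\<close>

lemma expected_excess_risk_le:
  "eexpectation M (\<lambda>\<omega>. excess_risk M X Y gaussian_linear
      (sample_minmax gaussian_linear n (xs \<omega>) (ys \<omega>)))
    \<le> enn2ereal (\<integral>\<^sup>+\<omega>. ennreal (ln (1 + lev {1..n} 0 (joint \<omega>))) \<partial>M)"
proof -
  obtain r where r: "0 \<le> r" "(INF \<theta>. risk M X Y (gaussian_linear \<theta>)) = ereal r"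
    and D: "(\<integral>\<^sup>+\<omega>. ennreal ((residual {0..n} 0 (joint \<omega>))\<^sup>2 / 2) \<partial>M) \<le> ennreal r"
    by (rule Inf_risk)
  let ?g = "\<lambda>\<omega>. \<integral>\<^sup>+\<omega>'. ennreal (smp_loss (fresh \<omega> \<omega>')) \<partial>M"
  have G: "(\<lambda>z. ennreal (smp_loss z)) \<in> borel_measurable N"
    using measurable_smp_loss by measurable
  have g: "?g \<in> borel_measurable M"
    and E: "(\<integral>\<^sup>+\<omega>. ennreal (smp_loss (joint \<omega>)) \<partial>M) = (\<integral>\<^sup>+\<omega>. ?g \<omega> \<partial>M)"
    using nn_integral_indep_split[of borel Z 0 "{1..n}" "\<lambda>z. ennreal (smp_loss z)"] indep n_pos G
    unfolding atLeast0_atMost_n[symmetric] by simp_all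
  have m: "(\<lambda>\<omega>. lev {1..n} 0 (joint \<omega>)) \<in> borel_measurable M"
    "(\<lambda>\<omega>. residual {0..n} 0 (joint \<omega>)) \<in> borel_measurable M"
    by (auto intro!: measurable_compose[OF rv_joint] borel_measurable_residual_lev)
  have "(\<integral>\<^sup>+\<omega>. ?g \<omega> \<partial>M) = (\<integral>\<^sup>+\<omega>. ennreal (ln (1 + lev {1..n} 0 (joint \<omega>)))
      + ennreal ((residual {0..n} 0 (joint \<omega>))\<^sup>2 / 2) \<partial>M)"
    unfolding E[symmetric]
  proof (rule nn_integral_cong_AE)
    show "AE \<omega> in M. ennreal (smp_loss (joint \<omega>)) = ennreal (ln (1 + lev {1..n} 0 (joint \<omega>)))
      + ennreal ((residual {0..n} 0 (joint \<omega>))\<^sup>2 / 2)"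
      using smp_loss_joint lev_nonneg by eventually_elim simp
  qed
  also have "\<dots> = (\<integral>\<^sup>+\<omega>. ennreal (ln (1 + lev {1..n} 0 (joint \<omega>))) \<partial>M)
      + (\<integral>\<^sup>+\<omega>. ennreal ((residual {0..n} 0 (joint \<omega>))\<^sup>2 / 2) \<partial>M)"
    using m by (intro nn_integral_add) auto
  also have "\<dots> \<le> (\<integral>\<^sup>+\<omega>. ennreal (ln (1 + lev {1..n} 0 (joint \<omega>))) \<partial>M) + ennreal r"
    using D by (rule add_left_mono)
  finally have le: "(\<integral>\<^sup>+\<omega>. ?g \<omega> \<partial>M)
      \<le> (\<integral>\<^sup>+\<omega>. ennreal (ln (1 + lev {1..n} 0 (joint \<omega>))) \<partial>M) + ennreal r" .
  have "AE \<omega> in M. excess_risk M X Y gaussian_linear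
      (sample_minmax gaussian_linear n (xs \<omega>) (ys \<omega>)) = enn2ereal (?g \<omega>) - ereal r"
    using risk_sample_minmax by eventually_elim (simp add: excess_risk_def r)
  then show ?thesis
    using g r(1) le by (rule eexpectation_minus_const_le)
qed

text \<open>The updated leverage is \<open>h / (1 + h)\<close>, so the argument of the logarithm is
  \<open>1 / (1 + h)\<close>.\<close>

lemma expected_log_leverage:
  "eexpectation M (\<lambda>\<omega>. - elog (ereal
      (1 - (matrix_inv (real n *\<^sub>R emp_cov n (xs \<omega>) + outer (X \<omega>)) *v X \<omega>) \<bullet> X \<omega>)))
    = enn2ereal (\<integral>\<^sup>+\<omega>. ennreal (ln (1 + lev {1..n} 0 (joint \<omega>))) \<partial>M)"
proof (rule eexpectation_AE_nonneg)
  show "AE \<omega> in M. - elog (ereal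
      (1 - (matrix_inv (real n *\<^sub>R emp_cov n (xs \<omega>) + outer (X \<omega>)) *v X \<omega>) \<bullet> X \<omega>))
    = ereal (ln (1 + lev {1..n} 0 (joint \<omega>))) \<and> 0 \<le> ln (1 + lev {1..n} 0 (joint \<omega>))"
    using inv_gram lev_nonneg
  proof eventually_elim
    case (elim \<omega>)
    let ?h = "lev {1..n} 0 (joint \<omega>)"
    have "real n *\<^sub>R emp_cov n (xs \<omega>) + outer (X \<omega>) = gram (insert 0 {1..n}) (xs \<omega>)"
      using n_pos by (simp add: gram_emp_cov gram_insert)
    then have "(matrix_inv (real n *\<^sub>R emp_cov n (xs \<omega>) + outer (X \<omega>)) *v X \<omega>) \<bullet> X \<omega> = ?h / (1 + ?h)"
      using least_squares_insert(2)[of "{1..n}" 0 "xs \<omega>"] elim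
      by (simp add: leverage_def residual_lev_joint)
    moreover have "1 - ?h / (1 + ?h) = exp (- ln (1 + ?h))"
      using elim by (simp add: exp_minus field_simps)
    ultimately show ?case
      using elim by (simp add: elog_exp)
  qed
qed

text \<open>Given the sample, the leverage of the test point is the trace of
  \<open>?B ** outer (X \<omega>')\<close>, linear in the outer product, so averaging over the test
  point replaces the latter by \<open>\<Sigma>\<close>.\<close>

lemma expected_leverage:
  defines "\<Sigma> \<equiv> \<integral>\<omega>. outer (X \<omega>) \<partial>M"
  assumes \<Sigma>: "invertible \<Sigma>"
  shows "enn2ereal (\<integral>\<^sup>+\<omega>. ennreal (lev {1..n} 0 (joint \<omega>)) \<partial>M)
    = ereal (1 / real n) *
      eexpectation M (\<lambda>\<omega>. ereal (trace (matrix_inv (whiten \<Sigma> (emp_cov n (xs \<omega>))))))"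
proof -
  let ?t = "\<lambda>\<omega>. trace (matrix_inv (whiten \<Sigma> (emp_cov n (xs \<omega>))))"
  let ?K = "\<lambda>\<omega>. \<integral>\<^sup>+\<omega>'. ennreal (lev {1..n} 0 (fresh \<omega> \<omega>')) \<partial>M"
  have X: "X \<in> borel_measurable M"
    by (rule rv_X)
  have G: "(\<lambda>z. ennreal (lev {1..n} 0 z)) \<in> borel_measurable N"
    by (intro measurable_compose[OF _ measurable_ennreal] borel_measurable_residual_lev) auto
  have K: "?K \<in> borel_measurable M"
    and E: "(\<integral>\<^sup>+\<omega>. ennreal (lev {1..n} 0 (joint \<omega>)) \<partial>M) = (\<integral>\<^sup>+\<omega>. ?K \<omega> \<partial>M)"
    using nn_integral_indep_split[of borel Z 0 "{1..n}" "\<lambda>z. ennreal (lev {1..n} 0 z)"] indep n_pos G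
    unfolding atLeast0_atMost_n[symmetric] by simp_all
  have t: "AE \<omega> in M. 0 \<le> ?t \<omega> \<and> ennreal (?t \<omega>) = ennreal (real n) * ?K \<omega>"
    using inv
  proof eventually_elim
    case (elim \<omega>)
    let ?B = "matrix_inv (gram {1..n} (xs \<omega>))"
    note inv' = invertible_emp_cov(2)[OF elim]
    have lin: "linear (\<lambda>A. trace (?B ** A))"
      by (auto intro!: linearI simp: matrix_add_ldistrib trace_add matrix_scalar_ac)
        (simp add: trace_def sum_distrib_left flip: scalar_matrix_assoc)
    have eq: "trace (?B ** outer (X \<omega>')) = lev {1..n} 0 (fresh \<omega> \<omega>')" for \<omega>'
      unfolding trace_mult_outer residual_lev_fresh leverage_def ..
    have nonneg: "0 \<le> lev {1..n} 0 (fresh \<omega> \<omega>')" for \<omega>'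
      unfolding eq[symmetric] trace_mult_outer using leverage_nonneg[OF inv'] by (simp add: leverage_def)
    have "?K \<omega> = ennreal (trace (?B ** \<Sigma>))"
      unfolding \<Sigma>_def integral_outer(2)[OF X square_X lin] eq
      using integral_outer(1)[OF X square_X lin] nonneg
      by (subst nn_integral_eq_integral) (auto simp: eq)
    moreover have "0 \<le> trace (?B ** \<Sigma>)"
      unfolding \<Sigma>_def integral_outer(2)[OF X square_X lin] eq using nonneg by simp
    moreover have "?t \<omega> = real n * trace (?B ** \<Sigma>)"
    proof -
      have "?t \<omega> = trace (matrix_inv (emp_cov n (xs \<omega>)) ** \<Sigma>)"
        unfolding \<Sigma>_def
        using integral_outer_psd[OF X square_X] \<Sigma> elim unfolding \<Sigma>_def
        by (intro trace_matrix_inv_whiten) auto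
      \<comment> \<open>The normalization of the covariance by \<open>1 / n\<close> becomes a factor
        \<open>n\<close> on its inverse; this is the source of \<open>1 / n\<close> in the
        bound.\<close>
      also have "matrix_inv (emp_cov n (xs \<omega>)) = real n *\<^sub>R ?B"
        using invertible_scaleR(2)[OF inv', of "1 / real n"] n_pos by (simp add: gram_emp_cov)
      finally show ?thesis
        by (simp add: trace_def sum_distrib_left flip: scalar_matrix_assoc)
    qed
    ultimately show ?case
      by (simp add: ennreal_mult)
  qed
  have "eexpectation M (\<lambda>\<omega>. ereal (?t \<omega>)) = enn2ereal (\<integral>\<^sup>+\<omega>. ennreal (?t \<omega>) \<partial>M)"
    using t by (intro eexpectation_AE_nonneg) auto
  also have "(\<integral>\<^sup>+\<omega>. ennreal (?t \<omega>) \<partial>M) = (\<integral>\<^sup>+\<omega>. ennreal (real n) * ?K \<omega> \<partial>M)"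
    using t by (intro nn_integral_cong_AE) auto
  also have "\<dots> = ennreal (real n) * (\<integral>\<^sup>+\<omega>. ?K \<omega> \<partial>M)"
    using K by (rule nn_integral_cmult)
  finally have "eexpectation M (\<lambda>\<omega>. ereal (?t \<omega>))
      = ereal (real n) * enn2ereal (\<integral>\<^sup>+\<omega>. ?K \<omega> \<partial>M)"
    by (simp add: times_ennreal.rep_eq)
  then show ?thesis
    unfolding E using n_pos
    by (simp add: mult.assoc[symmetric] one_ereal_def[symmetric])
qed

lemma log_leverage_le:
  defines "\<Sigma> \<equiv> \<integral>\<omega>. outer (X \<omega>) \<partial>M"
  assumes \<Sigma>: "invertible \<Sigma>"
  shows "enn2ereal (\<integral>\<^sup>+\<omega>. ennreal (ln (1 + lev {1..n} 0 (joint \<omega>))) \<partial>M)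
    \<le> elog (1 + ereal (1 / real n) *
      eexpectation M (\<lambda>\<omega>. ereal (trace (matrix_inv (whiten \<Sigma> (emp_cov n (xs \<omega>)))))))"
proof -
  have "(\<lambda>\<omega>. lev {1..n} 0 (joint \<omega>)) \<in> borel_measurable M"
    by (auto intro!: measurable_compose[OF rv_joint] borel_measurable_residual_lev)
  from nn_integral_ln_le_elog[OF this lev_nonneg] show ?thesis
    using \<Sigma> unfolding \<Sigma>_def by (simp only: expected_leverage)
qed

end

text \<open>The combined family holds the test point at index 0, so it agrees with the given sample
  only on \<open>{1..n}\<close>; the sample quantities look at no other index.\<close>

lemma sample_cong:
  assumes "\<And>i. i \<in> {1..n} \<Longrightarrow> xs i = xs' i" "\<And>i. i \<in> {1..n} \<Longrightarrow> ys i = ys' i"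
  shows "emp_cov n xs = emp_cov n xs'"
    and "sample_minmax gaussian_linear n xs ys = sample_minmax gaussian_linear n xs' ys'"
proof -
  show "emp_cov n xs = emp_cov n xs'"
    using assms by (simp add: emp_cov_def cong: sum.cong_simp)
  have "augmented_mle gaussian_linear n xs ys = augmented_mle gaussian_linear n xs' ys'"
    using assms by (simp add: augmented_mle_def fun_eq_iff cong: sum.cong_simp)
  then show "sample_minmax gaussian_linear n xs ys = sample_minmax gaussian_linear n xs' ys'"
    by (simp add: sample_minmax_def fun_eq_iff)
qed

theorem theorem4:
  fixes M :: "'w measure"
    and X :: "'w \<Rightarrow> real ^ 'd" and Y :: "'w \<Rightarrow> real"
    and Xs :: "nat \<Rightarrow> 'w \<Rightarrow> real ^ 'd" and Ys :: "nat \<Rightarrow> 'w \<Rightarrow> real"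
    and n :: nat and \<Sigma> :: "real ^ 'd ^ 'd"
  assumes "prob_space M"
    and "prob_space.indep_vars M (\<lambda>_. borel)
           (\<lambda>i \<omega>. if i = 0 then (X \<omega>, Y \<omega>) else (Xs i \<omega>, Ys i \<omega>)) {0..n}"
    and "\<And>i. i \<in> {1..n} \<Longrightarrow>
           distr M borel (\<lambda>\<omega>. (Xs i \<omega>, Ys i \<omega>)) = distr M borel (\<lambda>\<omega>. (X \<omega>, Y \<omega>))"
    and "integrable M (\<lambda>\<omega>. (norm (X \<omega>))\<^sup>2)"
    and "integrable M (\<lambda>\<omega>. (Y \<omega>)\<^sup>2)"
    and "\<Sigma> = (\<integral>\<omega>. outer (X \<omega>) \<partial>M)"
    and "invertible \<Sigma>"
    and "AE \<omega> in M. invertible (emp_cov n (\<lambda>i. Xs i \<omega>))"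
  shows "(AE \<omega> in M. \<forall>x.
            sample_minmax gaussian_linear n (\<lambda>i. Xs i \<omega>) (\<lambda>i. Ys i \<omega>) x =
            gaussian (ols n (\<lambda>i. Xs i \<omega>) (\<lambda>i. Ys i \<omega>) \<bullet> x)
              ((1 + (matrix_inv (real n *\<^sub>R emp_cov n (\<lambda>i. Xs i \<omega>)) *v x) \<bullet> x)\<^sup>2))
       \<and> eexpectation M (\<lambda>\<omega>. excess_risk M X Y gaussian_linear
              (sample_minmax gaussian_linear n (\<lambda>i. Xs i \<omega>) (\<lambda>i. Ys i \<omega>)))
           \<le> eexpectation M (\<lambda>\<omega>. - elog (ereal
               (1 - (matrix_inv (real n *\<^sub>R emp_cov n (\<lambda>i. Xs i \<omega>) + outer (X \<omega>)) *v X \<omega>) \<bullet> X \<omega>)))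
       \<and> eexpectation M (\<lambda>\<omega>. - elog (ereal
               (1 - (matrix_inv (real n *\<^sub>R emp_cov n (\<lambda>i. Xs i \<omega>) + outer (X \<omega>)) *v X \<omega>) \<bullet> X \<omega>)))
           \<le> elog (1 + ereal (1 / real n) *
               eexpectation M (\<lambda>\<omega>. ereal (trace (matrix_inv (whiten \<Sigma> (emp_cov n (\<lambda>i. Xs i \<omega>)))))))"
proof -
  let ?Z = "\<lambda>i \<omega>. if i = 0 then (X \<omega>, Y \<omega>) else (Xs i \<omega>, Ys i \<omega>)"
  have emp_cov: "emp_cov n (\<lambda>i. fst (?Z i \<omega>)) = emp_cov n (\<lambda>i. Xs i \<omega>)"
    and smp: "sample_minmax gaussian_linear n (\<lambda>i. fst (?Z i \<omega>)) (\<lambda>i. snd (?Z i \<omega>))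
      = sample_minmax gaussian_linear n (\<lambda>i. Xs i \<omega>) (\<lambda>i. Ys i \<omega>)" for \<omega>
    by (auto intro!: sample_cong)
  interpret prob_space M by fact
  interpret regression_sample M ?Z n
    using assms emp_cov by unfold_locales (simp_all del: One_nat_def)
  have "AE \<omega> in M. \<forall>x.
      sample_minmax gaussian_linear n (\<lambda>i. Xs i \<omega>) (\<lambda>i. Ys i \<omega>) x =
      gaussian (ols n (\<lambda>i. Xs i \<omega>) (\<lambda>i. Ys i \<omega>) \<bullet> x)
        ((1 + (matrix_inv (real n *\<^sub>R emp_cov n (\<lambda>i. Xs i \<omega>)) *v x) \<bullet> x)\<^sup>2)"
    using assms(8)
    by eventually_elim
      (simp add: sample_minmax_gaussian_linear leverage_def gram_emp_cov(2) n_pos)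
  then show ?thesis
    using expected_excess_risk_le expected_log_leverage log_leverage_le assms(6,7)
    unfolding emp_cov smp by simp
qed

end
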